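(* Let $N\ge2$. For $1\le j\le N$ let $T_j:D(T_j)\subseteq X\to X$ be a linear mapping, and let $C\in L(X)$ be an injective mapping such that $R(C)\subseteq D_\infty(T_j)$ and $T_j^kC\in L(X)$ for all $k\in\mathbb N$ and $1\le j\le N$. Suppose that exactly one of the following two conditions holds: (i) $X$ is a Banach space and for each $1\le j\le N$ we have $\sum_{k=1}^\infty\frac1{\|T_j^kC\|}<\infty$; (ii) $X$ is a complex Hilbert space and for each $1\le j\le N$ we have $\sum_{k=1}^\infty\frac1{\|T_j^kC\|^2}<\infty$. Then there exists $x\in X$ such that $\lim_{k\to\infty}\|T_j^kCx\|=\infty$ for each $1\le j\le N$.
   Context: $X$ is a non-trivial space over $\mathbb K\in\{\mathbb R,\mathbb C\}$. $L(X)$ is the space of bounded linear operators on $X$ with operator norm $\|\cdot\|$, $R(C)$ is the range of $C$, and $D_\infty(T)=\bigcap_{n\in\mathbb N}D(T^n)$. *)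

theory Defs
  imports "HOL-Analysis.Analysis"
begin

text \<open>
  The scalar field is a subfield \<open>K\<close> of the complex numbers, either \<open>\<real>\<close> or all of them, and a
  normed space over \<open>K\<close> is a real normed space whose real scalar multiplication is extended to
  \<open>K\<close>.  Only the values of \<open>smul c\<close> for \<open>c \<in> K\<close> are meaningful.
\<close>

definition normed_space_over ::
  "complex set \<Rightarrow> (complex \<Rightarrow> 'a::real_normed_vector \<Rightarrow> 'a) \<Rightarrow> bool" where
  "normed_space_over K smul \<longleftrightarrow>
     (K = \<real> \<or> K = UNIV) \<and>
     (\<forall>a\<in>K. \<forall>x y. smul a (x + y) = smul a x + smul a y) \<and>
     (\<forall>a\<in>K. \<forall>b\<in>K. \<forall>x. smul (a + b) x = smul a x + smul b x) \<and>
     (\<forall>a\<in>K. \<forall>b\<in>K. \<forall>x. smul a (smul b x) = smul (a * b) x) \<and>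
     (\<forall>r x. smul (of_real r) x = r *\<^sub>R x) \<and>
     (\<forall>a\<in>K. \<forall>x. norm (smul a x) = cmod a * norm x)"

text \<open>
  The inner product is linear in its first argument; the last clause says that it is positive
  definite and induces the given norm.
\<close>

definition complex_hilbert_space ::
  "complex set \<Rightarrow> (complex \<Rightarrow> 'a::real_normed_vector \<Rightarrow> 'a) \<Rightarrow> bool" where
  "complex_hilbert_space K smul \<longleftrightarrow>
     normed_space_over K smul \<and> K = UNIV \<and> complete (UNIV :: 'a set) \<and>
     (\<exists>ip :: 'a \<Rightarrow> 'a \<Rightarrow> complex.
        (\<forall>x y z. ip (x + y) z = ip x z + ip y z) \<and>
        (\<forall>c x y. ip (smul c x) y = c * ip x y) \<and>
        (\<forall>x y. ip y x = cnj (ip x y)) \<and>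
        (\<forall>x. ip x x = of_real ((norm x)\<^sup>2)))"

definition bounded_operators ::
  "complex set \<Rightarrow> (complex \<Rightarrow> 'a::real_normed_vector \<Rightarrow> 'a) \<Rightarrow> ('a \<Rightarrow> 'a) set" where
  "bounded_operators K smul =
     {A. bounded_linear A \<and> (\<forall>c\<in>K. \<forall>x. A (smul c x) = smul c (A x))}"

text \<open>
  An operator \<open>T : D \<subseteq> X \<rightarrow> X\<close> is represented by its domain \<open>D\<close> and a total function \<open>T\<close> whose
  values outside \<open>D\<close> are irrelevant.
\<close>

definition linear_operator_on ::
  "complex set \<Rightarrow> (complex \<Rightarrow> 'a::real_normed_vector \<Rightarrow> 'a) \<Rightarrow> 'a set \<Rightarrow> ('a \<Rightarrow> 'a) \<Rightarrow> bool" where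
  "linear_operator_on K smul D T \<longleftrightarrow>
     0 \<in> D \<and>
     (\<forall>x\<in>D. \<forall>y\<in>D. x + y \<in> D \<and> T (x + y) = T x + T y) \<and>
     (\<forall>c\<in>K. \<forall>x\<in>D. smul c x \<in> D \<and> T (smul c x) = smul c (T x))"

text \<open>The domain of the \<open>k\<close>-th power; on it, the power is given by \<open>T ^^ k\<close>.\<close>

primrec dom_power :: "'a set \<Rightarrow> ('a \<Rightarrow> 'a) \<Rightarrow> nat \<Rightarrow> 'a set" where
  "dom_power D T 0 = UNIV"
| "dom_power D T (Suc k) = {x \<in> D. T x \<in> dom_power D T k}"

definition dom_infinity :: "'a set \<Rightarrow> ('a \<Rightarrow> 'a) \<Rightarrow> 'a set" where
  "dom_infinity D T = (\<Inter>k. dom_power D T k)"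

text \<open>
  The series is taken in \<^typ>\<open>ennreal\<close>, so that \<open>1 / 0 = \<infinity>\<close>: finiteness of the sum forces all
  the norms with \<open>k \<ge> 1\<close> to be nonzero.
\<close>

definition reciprocal_norm_series ::
  "nat \<Rightarrow> ('a::real_normed_vector \<Rightarrow> 'a) \<Rightarrow> ('a \<Rightarrow> 'a) \<Rightarrow> ennreal" where
  "reciprocal_norm_series p T C =
     (\<Sum>k. 1 / ennreal (onorm (\<lambda>x. (T ^^ Suc k) (C x))) ^ p)"

end

theory Submission
  imports Defs "HOL-Complex_Analysis.Conformal_Mappings"
begin

text \<open>
  List the countably many operators \<open>T\<^sub>j\<^sup>k C\<close>, \<open>k \<ge> 1\<close>, as one sequence \<open>A\<^sub>i\<close>. By hypothesis
  \<open>\<Sum> \<parallel>A\<^sub>i\<parallel>\<^sup>-\<^sup>p\<close> converges, with \<open>p = 1\<close> for a Banach space and \<open>p = 2\<close> for a complex Hilbert space.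
  A convergent positive series still converges after its terms are multiplied by suitable
  weights \<open>b\<^sub>i\<close> tending to infinity (\<open>summable_times_unbounded\<close>), so \<open>w\<^sub>i = b\<^sub>i \<parallel>A\<^sub>i\<parallel>\<^sup>-\<^sup>p\<close> is summable.
  A plank theorem says that for summable \<open>w\<close> some vector \<open>z\<close> escapes all the thin slabs in which
  \<open>A\<^sub>i\<close> is small: \<open>\<parallel>A\<^sub>i z\<parallel> \<ge> c w\<^sub>i\<^sup>1\<^sup>/\<^sup>p \<parallel>A\<^sub>i\<parallel>\<close> for all \<open>i\<close>. The right-hand side is \<open>c b\<^sub>i\<^sup>1\<^sup>/\<^sup>p\<close>, which
  tends to infinity, and it does so along each of the finitely many subsequences that belong to
  a single \<open>T\<^sub>j\<close> (\<open>orbits_tend_to_infinity\<close>).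

  The two plank theorems are due to K. Ball; here they are needed only up to constants, and only
  for slabs centred at the origin.

  In a Banach space (\<open>plank_operators\<close>), choose unit vectors \<open>x\<^sub>i\<close> that almost norm \<open>A\<^sub>i\<close>, and
  functionals of norm one that norm \<open>A\<^sub>i x\<^sub>i\<close>. Looking for \<open>z\<close> of the form \<open>\<Sum> \<surd>w\<^sub>j c\<^sub>j x\<^sub>j\<close> with
  \<open>\<Sum> c\<^sub>j\<^sup>2 \<le> \<Sum> w\<^sub>j\<close> turns the question into one about real square matrices with unit diagonal
  (\<open>plank_matrix\<close>). For a symmetric matrix, Bang's choice of signs solves it; the general case is
  reduced to the symmetric one by passing to a suitable orthonormal basis, found as the
  minimiser of a function whose critical points are the bases that symmetrise the matrix.

  In a complex Hilbert space (\<open>plank_operators_Hilbert\<close>), finitely many functionals \<open>f\<^sub>k\<close> with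
  multiplicities \<open>m\<^sub>k\<close> are handled by almost maximising \<open>\<Prod> \<bar>f\<^sub>k z\<bar> ^ m\<^sub>k\<close> over the unit sphere: if one
  \<open>f\<^sub>j z\<close> were too small, then moving \<open>z\<close> along an orthogonal complex line would meet a zero of high
  order too close to \<open>z\<close>, and the maximum modulus principle would force the product to increase
  too much (\<open>plank_multiplicities\<close>).

  In both cases the vectors found for the first \<open>n\<close> operators must converge as \<open>n\<close> grows. In the
  Banach case a subsequence of the coefficients converges coordinatewise, and the Cauchy-Schwarz
  inequality makes the tails uniformly small in norm. In the Hilbert case a weak limit is taken.
\<close>

section \<open>Norming functionals on finitely many vectors\<close>

definition sublinear :: "('a::real_vector \<Rightarrow> real) \<Rightarrow> bool" where
  "sublinear p \<longleftrightarrow> (\<forall>x y. p (x + y) \<le> p x + p y) \<and> (\<forall>r x. 0 \<le> r \<longrightarrow> p (r *\<^sub>R x) = r * p x)"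

lemma sublinearD:
  assumes "sublinear p"
  shows "p (x + y) \<le> p x + p y" "0 \<le> r \<Longrightarrow> p (r *\<^sub>R x) = r * p x" "p 0 = 0" "- p x \<le> p (- x)"
proof -
  show 1: "p (x + y) \<le> p x + p y" for x y
    using assms by (simp add: sublinear_def)
  show 2: "0 \<le> r \<Longrightarrow> p (r *\<^sub>R x) = r * p x"
    using assms by (simp add: sublinear_def)
  show 3: "p 0 = 0"
    using assms unfolding sublinear_def by (metis lambda_zero order_refl scale_zero_left)
  show "- p x \<le> p (- x)"
    using 1[of x "-x"] 3 by simp
qed

text \<open>
  The step of the Hahn-Banach theorem in its form for sublinear functionals: the infimum of
  \<open>p (x + t v) - t p v\<close> over \<open>t \<ge> 0\<close> is again sublinear, and it is additive on the line through \<open>v\<close>.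
\<close>
lemma sublinear_minorant_additive_at:
  fixes v :: "'a::real_vector"
  assumes p: "sublinear p"
  obtains q where "sublinear q" "\<And>x. q x \<le> p x" "q (- v) \<le> - p v"
proof -
  define g where "g x t = p (x + t *\<^sub>R v) - t * p v" for x :: 'a and t :: real
  define q where "q x = (INF t\<in>{0..}. g x t)" for x
  have low: "- p (- x) \<le> g x t" if "t \<ge> 0" for x t
    using sublinearD(1)[OF p, of "x + t *\<^sub>R v" "- x"] sublinearD(2)[OF p that, of v]
    by (simp add: g_def)
  have bdd: "bdd_below (g x ` {0..})" for x
    using low by (intro bdd_belowI[of _ "- p (- x)"]) auto
  have qle: "q x \<le> g x t" if "t \<ge> 0" for x t
    unfolding q_def using that by (intro cINF_lower[OF bdd]) auto
  have qge: "m \<le> q x" if "\<And>t. t \<ge> 0 \<Longrightarrow> m \<le> g x t" for x m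
    unfolding q_def using that by (intro cINF_greatest) auto
  have add: "q (x + y) \<le> q x + q y" for x y
  proof -
    have "q (x + y) - g x s \<le> g y t" if "s \<ge> 0" "t \<ge> 0" for s t
    proof -
      have "q (x + y) \<le> g (x + y) (s + t)" using that by (intro qle) auto
      also have "x + y + (s + t) *\<^sub>R v = (x + s *\<^sub>R v) + (y + t *\<^sub>R v)"
        by (simp add: algebra_simps)
      then have "g (x + y) (s + t) \<le> g x s + g y t"
        using sublinearD(1)[OF p, of "x + s *\<^sub>R v" "y + t *\<^sub>R v"]
        by (simp add: g_def algebra_simps)
      finally show ?thesis by simp
    qed
    then have "q (x + y) - g x s \<le> q y" if "s \<ge> 0" for s
      using that by (intro qge) auto
    then have "q (x + y) - q y \<le> q x"
      by (intro qge) (simp add: algebra_simps)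
    then show ?thesis by simp
  qed
  have hom: "r * q x \<le> q (r *\<^sub>R x)" if "r > 0" for r x
  proof (rule qge)
    fix t :: real assume t: "t \<ge> 0"
    have "r *\<^sub>R x + t *\<^sub>R v = r *\<^sub>R (x + (t / r) *\<^sub>R v)"
      using that by (simp add: algebra_simps)
    then have "p (r *\<^sub>R x + t *\<^sub>R v) = r * p (x + (t / r) *\<^sub>R v)"
      using sublinearD(2)[OF p, of r "x + (t / r) *\<^sub>R v"] that by simp
    then have "g (r *\<^sub>R x) t = r * g x (t / r)"
      unfolding g_def using that by (simp add: algebra_simps)
    then show "r * q x \<le> g (r *\<^sub>R x) t" using qle[of "t / r" x] t that by simp
  qed
  have q0: "q 0 = 0"
  proof (rule antisym)
    show "q 0 \<le> 0" using qle[of 0 0] sublinearD(3)[OF p] by (simp add: g_def)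
    show "0 \<le> q 0" using low[of _ 0] sublinearD(3)[OF p] by (intro qge) simp
  qed
  have hom': "q (r *\<^sub>R x) = r * q x" if "r \<ge> 0" for r x
  proof (cases "r = 0")
    case False
    with that have r: "r > 0" by simp
    have "(1/r) * q (r *\<^sub>R x) \<le> q x" using hom[of "1/r" "r *\<^sub>R x"] r by simp
    then have "q (r *\<^sub>R x) \<le> r * q x" using r by (simp add: field_simps)
    with hom[OF r] show ?thesis by (intro antisym)
  qed (simp add: q0)
  have "q x \<le> p x" for x using qle[of 0 x] by (simp add: g_def)
  moreover have "q (- v) \<le> - p v"
    using qle[of 1 "- v"] sublinearD(3)[OF p] by (simp add: g_def)
  ultimately show thesis using that[of q] add hom' by (auto simp: sublinear_def)
qed

text \<open>
  The step can be iterated, because additivity on a line is inherited by every smaller sublinear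
  functional: \<open>r \<le> q\<close> and \<open>q (- v) = - q v\<close> give \<open>r (- v) \<le> - q v \<le> - r v\<close>. Finitely many steps
  suffice for the span of finitely many vectors.
\<close>
lemma sublinear_minorant_additive_on:
  fixes v :: "nat \<Rightarrow> 'a::real_vector"
  assumes "sublinear p"
  shows "\<exists>q. sublinear q \<and> (\<forall>x. q x \<le> p x) \<and> (\<forall>i<n. q (- v i) = - q (v i))"
proof (induction n)
  case 0
  then show ?case using assms by auto
next
  case (Suc n)
  then obtain q where q: "sublinear q" "\<And>x. q x \<le> p x" "\<And>i. i < n \<Longrightarrow> q (- v i) = - q (v i)" by auto
  obtain r where r: "sublinear r" "\<And>x. r x \<le> q x" "r (- v n) \<le> - q (v n)"
    using sublinear_minorant_additive_at[OF q(1)] by metis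
  have "r (- v i) = - r (v i)" if "i < Suc n" for i
  proof (rule antisym)
    have "r (- v i) \<le> - q (v i)"
      using that r(3) q(3)[of i] r(2)[of "- v i"] by (cases "i = n") auto
    then show "r (- v i) \<le> - r (v i)" using r(2)[of "v i"] by simp
  qed (rule sublinearD(4)[OF r(1)])
  then show ?case using r q(2) by (meson order_trans)
qed

lemma sublinear_sum:
  assumes "sublinear q" "finite A"
  shows "q (\<Sum>i\<in>A. f i) \<le> (\<Sum>i\<in>A. q (f i))"
  using assms(2)
proof (induction A rule: finite_induct)
  case empty
  then show ?case by (simp add: sublinearD[OF assms(1)])
next
  case (insert x A)
  then show ?case using sublinearD(1)[OF assms(1), of "f x" "sum f A"] by simp
qed

text \<open>
  The numbers \<open>\<phi> j\<close> are the values at \<open>v j\<close> of a linear functional of norm at most one on the span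
  that attains the norm of \<open>v i\<close>. The vector \<open>v i\<close> is treated before all the others, which
  forces the value there to be the norm.
\<close>
lemma norming_functional:
  fixes v :: "nat \<Rightarrow> 'a::real_normed_vector"
  shows "\<exists>\<phi>. \<phi> i = norm (v i) \<and> (\<forall>c. \<bar>\<Sum>j<n. c j * \<phi> j\<bar> \<le> norm (\<Sum>j<n. c j *\<^sub>R v j))"
proof -
  have "sublinear (norm :: 'a \<Rightarrow> real)" by (auto simp: sublinear_def norm_triangle_ineq)
  then obtain p :: "'a \<Rightarrow> real" where p: "sublinear p" "\<And>x. p x \<le> norm x" "p (- v i) \<le> - norm (v i)"
    using sublinear_minorant_additive_at by metis
  obtain q where q: "sublinear q" "\<And>x. q x \<le> p x" "\<And>j. j < n \<Longrightarrow> q (- v j) = - q (v j)"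
    using sublinear_minorant_additive_on[OF p(1)] by metis
  have scale: "q (c *\<^sub>R v j) = c * q (v j)" if "j < n" for c j
  proof (cases "c \<ge> 0")
    case False
    then have "q (c *\<^sub>R v j) = q ((- c) *\<^sub>R (- v j))" by simp
    also have "\<dots> = (- c) * q (- v j)" using False by (intro sublinearD(2)[OF q(1)]) simp
    finally show ?thesis using q(3)[OF that] by simp
  qed (simp add: sublinearD(2)[OF q(1)])
  have le: "(\<Sum>j<n. c j * q (v j)) \<le> norm (\<Sum>j<n. c j *\<^sub>R v j)" for c
  proof -
    have "(\<Sum>j<n. c j * q (v j)) = - (\<Sum>j<n. q (- c j *\<^sub>R v j))"
      by (simp add: scale[of _ "- c _"] sum_negf del: scale_minus_left)
    also have "\<dots> \<le> - q (\<Sum>j<n. - c j *\<^sub>R v j)"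
      using sublinear_sum[OF q(1), of "{..<n}"] by simp
    also have "\<dots> = - q (- (\<Sum>j<n. c j *\<^sub>R v j))" by (simp add: sum_negf)
    also have "\<dots> \<le> q (\<Sum>j<n. c j *\<^sub>R v j)" 
      using sublinearD(4)[OF q(1), of "- (\<Sum>j<n. c j *\<^sub>R v j)"] by simp
    also have "\<dots> \<le> norm (\<Sum>j<n. c j *\<^sub>R v j)" using q(2) p(2) order_trans by blast
    finally show ?thesis .
  qed
  have "\<bar>\<Sum>j<n. c j * q (v j)\<bar> \<le> norm (\<Sum>j<n. c j *\<^sub>R v j)" for c
    using le[of c] le[of "\<lambda>j. - c j"] by (auto simp: sum_negf)
  moreover have "q (v i) = norm (v i)"
  proof (rule antisym)
    show "q (v i) \<le> norm (v i)" using q(2) p(2) order_trans by blast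
    show "norm (v i) \<le> q (v i)"
      using q(2)[of "- v i"] p(3) sublinearD(4)[OF q(1), of "v i"] by simp
  qed
  ultimately show ?thesis by (intro exI[of _ "\<lambda>j. q (v j)"]) auto
qed

section \<open>The plank theorem for matrices\<close>

text \<open>
  Bang's lemma: choose the signs that maximise the quadratic form \<open>\<Sum> H i j * e i * e j\<close>. Flipping
  \<open>e i\<close> does not increase it, so the off-diagonal part of row \<open>i\<close> has the same sign as \<open>e i\<close> and
  cannot cancel the diagonal entry.
\<close>
lemma bang_signs:
  fixes H :: "nat \<Rightarrow> nat \<Rightarrow> real"
  assumes sym: "\<And>i j. i < n \<Longrightarrow> j < n \<Longrightarrow> H i j = H j i"
  shows "\<exists>e. \<forall>i<n. e i \<in> {-1, 1} \<and> H i i \<le> \<bar>\<Sum>j<n. H i j * e j\<bar>"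
proof -
  define E where "E = ({..<n} \<rightarrow>\<^sub>E {-1, 1 :: real})"
  define Q where "Q e = (\<Sum>i<n. \<Sum>j<n. H i j * e i * e j)" for e
  have "finite E" "E \<noteq> {}" by (auto simp: E_def PiE_eq_empty_iff intro: finite_PiE)
  then obtain e where e: "e \<in> E" "\<And>e'. e' \<in> E \<Longrightarrow> Q e' \<le> Q e"
    using Max_in[of "Q ` E"] Max_ge[of "Q ` E"] by (metis (no_types, lifting) finite_imageI imageE image_eqI image_is_empty)
  have eE: "e i \<in> {-1, 1}" if "i < n" for i using e(1) that by (auto simp: E_def)
  moreover have "H i i \<le> \<bar>\<Sum>j<n. H i j * e j\<bar>" if i: "i < n" for i
  proof -
    define R where "R = {..<n} - {i}"
    define S where "S = (\<Sum>j\<in>R. H i j * e j)"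
    have fin: "finite R" "i \<notin> R" "{..<n} = insert i R" using i by (auto simp: R_def)
    have split: "Q f = H i i * f i * f i + 2 * f i * (\<Sum>j\<in>R. H i j * f j) + (\<Sum>a\<in>R. \<Sum>b\<in>R. H a b * f a * f b)"
      for f
    proof -
      have "(\<Sum>a\<in>R. H a i * f a * f i) = (\<Sum>a\<in>R. H i a * f a) * f i"
        unfolding sum_distrib_right using sym i by (intro sum.cong) (auto simp: R_def)
      moreover have "(\<Sum>b\<in>R. H i b * f i * f b) = f i * (\<Sum>j\<in>R. H i j * f j)"
        unfolding sum_distrib_left by (intro sum.cong) auto
      ultimately show ?thesis
        unfolding Q_def fin(3) using fin(1,2) by (simp add: sum.distrib algebra_simps)
    qed
    define f where "f = e(i := - e i)"
    have "f \<in> E" using e(1) i eE by (fastforce simp: f_def E_def PiE_iff extensional_def)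
    then have "Q f \<le> Q e" by (rule e(2))
    moreover have "(\<Sum>j\<in>R. H i j * f j) = S"
      unfolding S_def f_def using fin(2) by (intro sum.cong) auto
    moreover have "(\<Sum>a\<in>R. \<Sum>b\<in>R. H a b * f a * f b) = (\<Sum>a\<in>R. \<Sum>b\<in>R. H a b * e a * e b)"
      unfolding f_def using fin(2) by (intro sum.cong) auto
    ultimately have "0 \<le> e i * S" using split[of e] split[of f] by (simp add: f_def S_def)
    moreover have "(\<Sum>j<n. H i j * e j) = H i i * e i + S"
      unfolding fin(3) S_def using fin(1,2) by simp
    ultimately show ?thesis using eE[OF i] by auto
  qed
  ultimately show ?thesis by blast
qed

lemma compact_Pi_UNIV:
  fixes B :: "'i \<Rightarrow> 'b::topological_space set"
  assumes "\<And>i. compact (B i)"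
  shows "compact {f. \<forall>i. f i \<in> B i}"
proof -
  have "compactin (product_topology (\<lambda>i. euclidean) UNIV) (PiE UNIV B)"
    using assms by (simp add: compactin_PiE compactin_euclidean_iff)
  moreover have "PiE UNIV B = {f. \<forall>i. f i \<in> B i}" by auto
  ultimately show ?thesis by (simp add: euclidean_product_topology compactin_euclidean_iff)
qed

text \<open>
  The inner product of \<open>\<real>\<^sup>n\<close>. Vectors are functions on \<open>nat\<close> of which only the first \<open>n\<close> entries
  matter, because the dimension is the number of operators considered, which later tends to infinity.
\<close>
definition dot :: "nat \<Rightarrow> (nat \<Rightarrow> real) \<Rightarrow> (nat \<Rightarrow> real) \<Rightarrow> real" where
  "dot n x y = (\<Sum>k<n. x k * y k)"

lemma dot_combine:
  "dot n (\<lambda>k. a * x k + b * y k) z = a * dot n x z + b * dot n y z"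
  "dot n (\<lambda>k. a * x k - b * y k) z = a * dot n x z - b * dot n y z"
  "dot n z (\<lambda>k. a * x k + b * y k) = a * dot n z x + b * dot n z y"
  "dot n z (\<lambda>k. a * x k - b * y k) = a * dot n z x - b * dot n z y"
  by (simp_all add: dot_def sum.distrib sum_subtractf sum_distrib_left algebra_simps)

definition orthonormal_rows :: "nat \<Rightarrow> (nat \<Rightarrow> nat \<Rightarrow> real) \<Rightarrow> bool" where
  "orthonormal_rows n u \<longleftrightarrow>
     (\<forall>i<n. \<forall>j<n. dot n (u i) (u j) = (if i = j then 1 else 0))"

lemma orthonormal_rows_entry_le_1:
  assumes "orthonormal_rows n u" "i < n" "k < n"
  shows "\<bar>u i k\<bar> \<le> 1"
proof -
  have "(u i k)\<^sup>2 \<le> (\<Sum>k<n. (u i k)\<^sup>2)" using assms(3) by (intro member_le_sum) auto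
  also have "\<dots> = 1" using assms by (auto simp: orthonormal_rows_def dot_def power2_eq_square)
  finally show ?thesis by (simp add: abs_square_le_1)
qed

lemma orthonormal_rows_rotate:
  assumes u: "orthonormal_rows n u" and ij: "i < n" "j < n" "i \<noteq> j"
  shows "orthonormal_rows n
    (u(i := (\<lambda>k. cos t * u i k + sin t * u j k), j := (\<lambda>k. cos t * u j k - sin t * u i k)))"
    (is "orthonormal_rows n ?v")
proof -
  have o: "dot n (u a) (u b) = (if a = b then 1 else 0)" if "a < n" "b < n" for a b
    using u that by (simp add: orthonormal_rows_def)
  have cs: "cos t * cos t + sin t * sin t = 1"
    by (metis sin_cos_squared_add3)
  have "dot n (?v a) (?v b) = (if a = b then 1 else 0)" if "a < n" "b < n" for a b
    using that ij cs by (simp add: dot_combine o algebra_simps)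
  then show ?thesis by (simp add: orthonormal_rows_def)
qed

text \<open>
  The standard basis gives the value \<open>\<Sum> w i\<close>. A system whose value is not larger
  satisfies \<open>dot n (g i) (u i) \<ge> w i / sqrt W\<close> for every \<open>i\<close>, where \<open>W = \<Sum> w i\<close>; this closed
  condition keeps the denominators away from zero, and the minimum is attained on the compact
  set that it defines.
\<close>
lemma orthonormal_minimizer:
  fixes g :: "nat \<Rightarrow> nat \<Rightarrow> real" and w :: "nat \<Rightarrow> real"
  assumes w: "\<And>i. i < n \<Longrightarrow> w i > 0" and g: "\<And>i. i < n \<Longrightarrow> g i i = sqrt (w i)"
  shows "\<exists>u. orthonormal_rows n u \<and> (\<forall>i<n. dot n (g i) (u i) > 0) \<and>
    (\<Sum>i<n. (w i / dot n (g i) (u i))\<^sup>2) \<le> (\<Sum>i<n. w i) \<and>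
    (\<forall>v. orthonormal_rows n v \<longrightarrow> (\<forall>i<n. dot n (g i) (v i) > 0) \<longrightarrow>
        (\<Sum>i<n. (w i / dot n (g i) (u i))\<^sup>2) \<le> (\<Sum>i<n. (w i / dot n (g i) (v i))\<^sup>2))"
proof (cases "n = 0")
  case True
  then show ?thesis by (auto simp: orthonormal_rows_def)
next
  case False
  define W where "W = (\<Sum>i<n. w i)"
  have W: "W > 0" unfolding W_def using False w by (intro sum_pos) auto
  define I :: "nat \<times> nat \<Rightarrow> real" where "I = (\<lambda>(i, k). if i < n \<and> i = k then 1 else 0)"
  define B where "B = {V :: nat \<times> nat \<Rightarrow> real. \<forall>p. V p \<in> {-1..1}}"
  define S where "S = B \<inter> {V. orthonormal_rows n (curry V) \<and> (\<forall>i<n. w i / sqrt W \<le> dot n (g i) ((curry V) i))}"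
  define G where "G u = (\<Sum>i<n. (w i / dot n (g i) (u i))\<^sup>2)" for u
  have cont: "continuous_on UNIV (\<lambda>V. dot n (g i) ((curry V) i))" for i
    unfolding dot_def curry_def by (intro continuous_intros continuous_on_product_coordinates)
  have "closed {V. orthonormal_rows n (curry V)}"
    unfolding orthonormal_rows_def dot_def curry_def
    by (intro closed_Collect_all closed_Collect_imp closed_Collect_eq continuous_intros
        continuous_on_product_coordinates) auto
  moreover have "closed {V. \<forall>i<n. w i / sqrt W \<le> dot n (g i) ((curry V) i)}"
    by (intro closed_Collect_all closed_Collect_imp closed_Collect_le cont continuous_intros) auto
  moreover have "S = B \<inter> ({V. orthonormal_rows n (curry V)} \<inter> {V. \<forall>i<n. w i / sqrt W \<le> dot n (g i) ((curry V) i)})"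
    by (auto simp: S_def)
  moreover have "compact B" unfolding B_def by (intro compact_Pi_UNIV) auto
  ultimately have "compact S" by (auto intro!: compact_Int_closed closed_Int)
  have sI: "dot n (g i) ((curry I) i) = sqrt (w i)" if "i < n" for i
  proof -
    have "dot n (g i) ((curry I) i) = (\<Sum>k<n. if k = i then g i k else 0)"
      unfolding dot_def I_def using that by (intro sum.cong) auto
    then show ?thesis using that g by simp
  qed
  have GI: "G (curry I) = W" 
    unfolding G_def W_def using w by (intro sum.cong) (auto simp: sI power_divide power2_eq_square less_imp_le)
  have wW: "w i \<le> W" if "i < n" for i
    unfolding W_def using that w by (intro member_le_sum) (auto intro: less_imp_le)
  have "I \<in> S"
  proof -
    have "orthonormal_rows n (curry I)"
    proof -
      have "dot n (curry I i) (curry I j) = (\<Sum>k<n. if k = i then (if i = j then 1 else 0) else 0)"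
        if "i < n" "j < n" for i j
        unfolding dot_def using that by (intro sum.cong) (auto simp: I_def)
      then show ?thesis by (simp add: orthonormal_rows_def)
    qed
    moreover have "w i / sqrt W \<le> dot n (g i) ((curry I) i)" if "i < n" for i
    proof -
      have "w i = sqrt (w i) * sqrt (w i)" using w[OF that] by simp
      also have "\<dots> \<le> sqrt (w i) * sqrt W" using wW[OF that] w[OF that] by (intro mult_left_mono) auto
      finally show ?thesis using W that by (simp add: sI field_simps)
    qed
    ultimately show ?thesis by (auto simp: S_def B_def I_def)
  qed
  have posS: "dot n (g i) ((curry V) i) > 0" if "V \<in> S" "i < n" for V i
  proof -
    have "0 < w i / sqrt W" using W w that(2) by simp
    also have "\<dots> \<le> dot n (g i) ((curry V) i)" using that by (auto simp: S_def)
    finally show ?thesis .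
  qed
  have "continuous_on S (\<lambda>V. G (curry V))"
    unfolding G_def using posS
    by (intro continuous_intros continuous_on_subset[OF cont]) (auto simp: less_imp_neq[THEN not_sym])
  then obtain V where V: "V \<in> S" "\<And>V'. V' \<in> S \<Longrightarrow> G (curry V) \<le> G (curry V')"
    using continuous_attains_inf[OF \<open>compact S\<close>, of "\<lambda>V. G (curry V)"] \<open>I \<in> S\<close> by auto
  have VW: "G (curry V) \<le> W" using V(2)[OF \<open>I \<in> S\<close>] GI by simp
  have "G (curry V) \<le> G v" if v: "orthonormal_rows n v" "\<And>i. i < n \<Longrightarrow> dot n (g i) (v i) > 0" for v
  proof (cases "\<forall>i<n. w i / sqrt W \<le> dot n (g i) (v i)")
    case True
    define V' where "V' = (\<lambda>(i, k). if i < n \<and> k < n then v i k else 0)"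
    have s': "dot n (g i) (curry V' i) = dot n (g i) (v i)" if "i < n" for i
      unfolding dot_def V'_def using that by (intro sum.cong) auto
    have "orthonormal_rows n (curry V')"
      using v(1) unfolding orthonormal_rows_def dot_def V'_def by simp
    moreover have "V' \<in> B"
      using orthonormal_rows_entry_le_1[OF v(1)] by (auto simp: B_def V'_def abs_le_iff)
    ultimately have "V' \<in> S" using True s' by (auto simp: S_def)
    moreover have "G (curry V') = G v" unfolding G_def by (intro sum.cong) (auto simp: s')
    ultimately show ?thesis using V(2)[of V'] by simp
  next
    case False
    then obtain i where i: "i < n" "dot n (g i) (v i) < w i / sqrt W" by auto
    then have "sqrt W \<le> w i / dot n (g i) (v i)" using v(2)[OF i(1)] W by (simp add: field_simps)
    then have "(sqrt W)\<^sup>2 \<le> (w i / dot n (g i) (v i))\<^sup>2" using W by (intro power_mono) auto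
    also have "\<dots> \<le> G v" unfolding G_def using i by (intro member_le_sum) auto
    finally show ?thesis using VW W by simp
  qed
  with V(1) posS[OF V(1)] VW show ?thesis
    by (intro exI[of _ "curry V"]) (simp add: S_def G_def W_def)
qed

text \<open>
  The equations in the conclusion say that the minimiser is a critical point: rotating \<open>u i\<close> and
  \<open>u j\<close> in the plane that they span must not change \<open>\<Sum> (w i / dot n (g i) (u i))\<^sup>2\<close> to first order.
\<close>
lemma orthonormal_symmetrization:
  fixes g :: "nat \<Rightarrow> nat \<Rightarrow> real" and w :: "nat \<Rightarrow> real"
  assumes w: "\<And>i. i < n \<Longrightarrow> w i > 0" and g: "\<And>i. i < n \<Longrightarrow> g i i = sqrt (w i)"
  shows "\<exists>u. orthonormal_rows n u \<and> (\<forall>i<n. dot n (g i) (u i) > 0) \<and>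
    (\<Sum>i<n. (w i / dot n (g i) (u i))\<^sup>2) \<le> (\<Sum>i<n. w i) \<and>
    (\<forall>i<n. \<forall>j<n. (w i)\<^sup>2 / dot n (g i) (u i) ^ 3 * dot n (g i) (u j) =
       (w j)\<^sup>2 / dot n (g j) (u j) ^ 3 * dot n (g j) (u i))"
proof -
  obtain u where u: "orthonormal_rows n u" and pos: "\<And>i. i < n \<Longrightarrow> dot n (g i) (u i) > 0"
    and le: "(\<Sum>i<n. (w i / dot n (g i) (u i))\<^sup>2) \<le> (\<Sum>i<n. w i)"
    and min: "\<And>v. orthonormal_rows n v \<Longrightarrow> (\<And>i. i < n \<Longrightarrow> dot n (g i) (v i) > 0) \<Longrightarrow>
        (\<Sum>i<n. (w i / dot n (g i) (u i))\<^sup>2) \<le> (\<Sum>i<n. (w i / dot n (g i) (v i))\<^sup>2)"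
    using orthonormal_minimizer[of n w g, OF w g] by blast
  have "(w i)\<^sup>2 / dot n (g i) (u i) ^ 3 * dot n (g i) (u j) = (w j)\<^sup>2 / dot n (g j) (u j) ^ 3 * dot n (g j) (u i)"
    if ij: "i < n" "j < n" "i \<noteq> j" for i j
  proof -
    define a where "a = dot n (g i) (u j)"
    define b where "b = dot n (g j) (u i)"
    define x where "x t = cos t * dot n (g i) (u i) + sin t * a" for t
    define y where "y t = cos t * dot n (g j) (u j) - sin t * b" for t
    define v where "v t = u(i := (\<lambda>k. cos t * u i k + sin t * u j k),
                            j := (\<lambda>k. cos t * u j k - sin t * u i k))" for t
    define f where "f t = (w i / x t)\<^sup>2 + (w j / y t)\<^sup>2" for t
    have sv: "dot n (g i) ((v t) i) = x t" "dot n (g j) ((v t) j) = y t" for t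
      using ij(3) by (simp_all add: v_def x_def y_def a_def b_def dot_combine)
    have sv': "dot n (g l) ((v t) l) = dot n (g l) (u l)" if "l \<noteq> i" "l \<noteq> j" for l t
      using that by (simp add: v_def)
    have "isCont x 0" "isCont y 0" unfolding x_def y_def by (intro continuous_intros)+
    moreover have xy0: "x 0 = dot n (g i) (u i)" "y 0 = dot n (g j) (u j)" by (auto simp: x_def y_def)
    ultimately have "(x \<longlongrightarrow> dot n (g i) (u i)) (nhds 0)" "(y \<longlongrightarrow> dot n (g j) (u j)) (nhds 0)"
      using tendsto_at_iff_tendsto_nhds[of x 0] tendsto_at_iff_tendsto_nhds[of y 0]
      by (simp_all add: isCont_def)
    then have "\<forall>\<^sub>F t in nhds 0. x t > 0 \<and> y t > 0"
      using pos[OF ij(1)] pos[OF ij(2)] by (intro eventually_conj order_tendstoD(1))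
    then obtain d where d: "d > 0" "\<And>t. \<bar>t\<bar> < d \<Longrightarrow> x t > 0 \<and> y t > 0"
      by (auto simp: eventually_nhds_metric dist_real_def)
    have fmin: "f 0 \<le> f t" if "\<bar>t\<bar> < d" for t
    proof -
      have rest: "(\<Sum>l<n. (w l / dot n (g l) (z l))\<^sup>2) = (w i / dot n (g i) (z i))\<^sup>2 + ((w j / dot n (g j) (z j))\<^sup>2 + (\<Sum>l\<in>{..<n}-{i}-{j}. (w l / dot n (g l) (z l))\<^sup>2))" for z
        using ij by (subst sum.remove[of _ i], simp, simp, subst sum.remove[of _ j]) auto
      have "(\<Sum>l<n. (w l / dot n (g l) (u l))\<^sup>2) \<le> (\<Sum>l<n. (w l / dot n (g l) ((v t) l))\<^sup>2)"
      proof (rule min)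
        show "orthonormal_rows n (v t)"
          unfolding v_def by (rule orthonormal_rows_rotate[OF u ij])
        show "dot n (g l) ((v t) l) > 0" if "l < n" for l
          using d(2)[OF \<open>\<bar>t\<bar> < d\<close>] pos[OF that] sv[of t] sv'[of l t] by metis
      qed
      moreover have "(\<Sum>l\<in>{..<n}-{i}-{j}. (w l / dot n (g l) ((v t) l))\<^sup>2) = (\<Sum>l\<in>{..<n}-{i}-{j}. (w l / dot n (g l) (u l))\<^sup>2)"
        by (intro sum.cong) (auto simp: sv')
      ultimately show ?thesis unfolding rest f_def by (simp add: sv xy0)
    qed
    have "(f has_real_derivative
       2 * (w i / dot n (g i) (u i)) * (- (w i * a / (dot n (g i) (u i))\<^sup>2)) + 2 * (w j / dot n (g j) (u j)) * (w j * b / (dot n (g j) (u j))\<^sup>2)) (at 0)"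
      unfolding f_def x_def y_def using pos[OF ij(1)] pos[OF ij(2)]
      by (auto intro!: derivative_eq_intros simp: power2_eq_square ac_simps)
    from DERIV_local_min[OF this d(1)] fmin
    have "2 * (w i / dot n (g i) (u i)) * (- (w i * a / (dot n (g i) (u i))\<^sup>2)) + 2 * (w j / dot n (g j) (u j)) * (w j * b / (dot n (g j) (u j))\<^sup>2) = 0"
      by simp
    then show ?thesis unfolding a_def[symmetric] b_def[symmetric]
      by (simp add: power2_eq_square power3_eq_cube)
  qed
  then have "(w i)\<^sup>2 / dot n (g i) (u i) ^ 3 * dot n (g i) (u j) = (w j)\<^sup>2 / dot n (g j) (u j) ^ 3 * dot n (g j) (u i)"
    if "i < n" "j < n" for i j
    using that by (cases "i = j") auto
  with u pos le show ?thesis by blast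
qed

text \<open>
  Ball's plank theorem in terms of a matrix. Let \<open>u\<close> be the orthonormal system of the previous
  lemma for the rows \<open>g i\<close> of the matrix with columns scaled by \<open>sqrt (w j)\<close>, and look for \<open>c\<close>
  as \<open>\<Sum> \<alpha> j e j u j\<close> with \<open>\<alpha> j = w j / dot n (g j) (u j)\<close> and signs \<open>e j\<close>. Every choice of signs
  gives \<open>\<Sum> (c j)\<^sup>2 = \<Sum> (\<alpha> j)\<^sup>2\<close>, the minimal value, which is at most \<open>\<Sum> w j\<close>, and Bang's
  lemma for the symmetrised matrix provides the signs for which every row is large.
\<close>
lemma plank_matrix:
  fixes a :: "nat \<Rightarrow> nat \<Rightarrow> real" and w :: "nat \<Rightarrow> real"
  assumes w: "\<And>i. i < n \<Longrightarrow> w i > 0" and diag: "\<And>i. i < n \<Longrightarrow> a i i = 1"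
  shows "\<exists>c. (\<Sum>j<n. (c j)\<^sup>2) \<le> (\<Sum>j<n. w j) \<and>
    (\<forall>i<n. w i \<le> \<bar>\<Sum>j<n. a i j * (sqrt (w j) * c j)\<bar>)"
proof -
  define g where "g i j = a i j * sqrt (w j)" for i j
  have gii: "g i i = sqrt (w i)" if "i < n" for i
    using diag[OF that] by (simp add: g_def)
  obtain u where u: "orthonormal_rows n u" and pos: "\<And>i. i < n \<Longrightarrow> dot n (g i) (u i) > 0"
    and le: "(\<Sum>i<n. (w i / dot n (g i) (u i))\<^sup>2) \<le> (\<Sum>i<n. w i)"
    and sym: "\<And>i j. i < n \<Longrightarrow> j < n \<Longrightarrow> (w i)\<^sup>2 / dot n (g i) (u i) ^ 3 * dot n (g i) (u j) =
       (w j)\<^sup>2 / dot n (g j) (u j) ^ 3 * dot n (g j) (u i)"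
    using orthonormal_symmetrization[of n w g, OF w gii] by blast
  define p where "p i j = dot n (g i) (u j)" for i j
  define \<alpha> where "\<alpha> i = w i / p i i" for i
  define \<theta> where "\<theta> i = (w i)\<^sup>2 / p i i ^ 3" for i
  define H where "H i j = \<alpha> i * \<theta> i * p i j * \<alpha> j" for i j
  have ppos: "p i i > 0" "\<alpha> i > 0" "\<theta> i > 0" if "i < n" for i
    using pos[OF that] w[OF that] by (auto simp: p_def \<alpha>_def \<theta>_def)
  have Hsym: "H i j = H j i" if "i < n" "j < n" for i j
  proof -
    have "\<theta> i * p i j = \<theta> j * p j i" using sym[OF that] by (simp add: p_def \<theta>_def)
    moreover have "H a b = \<alpha> a * \<alpha> b * (\<theta> a * p a b)" for a b by (simp add: H_def)
    ultimately show ?thesis by simp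
  qed
  obtain e where e: "\<And>i. i < n \<Longrightarrow> e i \<in> {-1, 1 :: real}"
    "\<And>i. i < n \<Longrightarrow> H i i \<le> \<bar>\<Sum>j<n. H i j * e j\<bar>"
    using bang_signs[of n H, OF Hsym] by blast
  define c where "c k = (\<Sum>j<n. \<alpha> j * e j * u j k)" for k
  have "(\<Sum>k<n. (c k)\<^sup>2) = (\<Sum>k<n. \<Sum>i<n. \<Sum>j<n. (\<alpha> i * e i * (\<alpha> j * e j)) * (u i k * u j k))"
    unfolding c_def power2_eq_square sum_product by (simp add: ac_simps)
  also have "\<dots> = (\<Sum>i<n. \<Sum>j<n. (\<alpha> i * e i * (\<alpha> j * e j)) * (\<Sum>k<n. u i k * u j k))"
    unfolding sum_distrib_left by (subst sum.swap, rule sum.cong[OF refl], rule sum.swap)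
  also have "\<dots> = (\<Sum>i<n. \<Sum>j<n. if j = i then (\<alpha> i)\<^sup>2 else 0)"
    using u e(1) unfolding orthonormal_rows_def dot_def
    by (intro sum.cong refl) (force simp: power2_eq_square)
  also have "\<dots> = (\<Sum>i<n. (\<alpha> i)\<^sup>2)" by simp
  also have "\<dots> \<le> (\<Sum>i<n. w i)" using le by (simp add: \<alpha>_def p_def)
  finally have 1: "(\<Sum>k<n. (c k)\<^sup>2) \<le> (\<Sum>i<n. w i)" .
  have 2: "w i \<le> \<bar>\<Sum>j<n. a i j * (sqrt (w j) * c j)\<bar>" if i: "i < n" for i
  proof -
    \<comment> \<open>Row \<open>i\<close> of the symmetric matrix \<open>H\<close> is this sum scaled by \<open>\<alpha> i * \<theta> i\<close>, which then cancels.\<close>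
    have eq: "(\<Sum>k<n. a i k * (sqrt (w k) * c k)) = (\<Sum>j<n. p i j * \<alpha> j * e j)"
      unfolding c_def p_def g_def dot_def sum_distrib_left sum_distrib_right
      by (subst sum.swap) (simp add: ac_simps)
    have "\<alpha> i * \<theta> i * w i = H i i" using ppos[OF i] by (simp add: H_def \<alpha>_def)
    also have "\<dots> \<le> \<bar>\<Sum>j<n. H i j * e j\<bar>" by (rule e(2)[OF i])
    also have "(\<Sum>j<n. H i j * e j) = (\<alpha> i * \<theta> i) * (\<Sum>j<n. p i j * \<alpha> j * e j)"
      by (simp add: H_def sum_distrib_left ac_simps)
    also have "\<bar>\<dots>\<bar> = (\<alpha> i * \<theta> i) * \<bar>\<Sum>j<n. p i j * \<alpha> j * e j\<bar>"
      using ppos[OF i] by (simp add: abs_mult)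
    finally show ?thesis using ppos[OF i] by (simp add: eq)
  qed
  show ?thesis using 1 2 by blast
qed

section \<open>Planks in Banach spaces\<close>

lemma bounded_linear_almost_norming_vector:
  assumes f: "bounded_linear f" and b: "b < onorm f" "0 \<le> b"
  shows "\<exists>x. norm x = 1 \<and> b < norm (f x)"
proof -
  interpret bounded_linear f by (rule f)
  obtain x where x: "norm (f x) > b * norm x"
    using onorm_bound[of b f] b by (meson not_le)
  have x0: "x \<noteq> 0" using x by (auto simp: zero)
  define y where "y = (1 / norm x) *\<^sub>R x"
  have "norm y = 1" using x0 by (simp add: y_def)
  moreover have "norm (f y) > b" using x x0 by (simp add: y_def scaleR field_simps)
  ultimately show ?thesis by blast
qed

lemma coordinatewise_convergent_subsequence:
  fixes c :: "nat \<Rightarrow> 'i::countable \<Rightarrow> 'b::{first_countable_topology, t2_space}"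
  assumes K: "\<And>i. compact (K i)" and c: "\<And>n i. c n i \<in> K i"
  shows "\<exists>l r. strict_mono r \<and> (\<forall>i. (\<lambda>n. c (r n) i) \<longlonglongrightarrow> l i)"
proof -
  have "seq_compact {f. \<forall>i. f i \<in> K i}"
    by (intro compact_imp_seq_compact compact_Pi_UNIV K)
  then obtain l r where r: "strict_mono (r :: nat \<Rightarrow> nat)" and l: "(c \<circ> r) \<longlonglongrightarrow> l"
    by (rule seq_compactE[where f = c]) (use c in auto)
  have "(\<lambda>n. c (r n) i) \<longlonglongrightarrow> l i" for i
    using continuous_on_tendsto_compose[OF continuous_on_product_coordinates[of i], OF l]
    by simp
  with r show ?thesis by blast
qed

lemma Cauchy_if_uniformly_approximable:
  fixes y :: "nat \<Rightarrow> 'a::real_normed_vector"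
  assumes "\<And>e. e > 0 \<Longrightarrow> \<exists>h. convergent h \<and> (\<forall>n. norm (y n - h n) \<le> e)"
  shows "Cauchy y"
proof (rule metric_CauchyI)
  fix e :: real assume e: "e > 0"
  then obtain h where h: "convergent h" "\<And>n. norm (y n - h n) \<le> e / 4"
    using assms[of "e / 4"] by auto
  obtain M where M: "\<And>m n. m \<ge> M \<Longrightarrow> n \<ge> M \<Longrightarrow> dist (h m) (h n) < e / 2"
    using convergent_Cauchy[OF h(1)] e unfolding Cauchy_def by (metis half_gt_zero)
  have "dist (y m) (y n) < e" if "m \<ge> M" "n \<ge> M" for m n
  proof -
    have "norm (y m - y n) = norm ((y m - h m) + (h m - h n) - (y n - h n))" by simp
    also have "\<dots> \<le> norm ((y m - h m) + (h m - h n)) + norm (y n - h n)"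
      by (rule norm_triangle_ineq4)
    also have "\<dots> \<le> norm (y m - h m) + norm (h m - h n) + norm (y n - h n)"
      by (rule add_right_mono) (rule norm_triangle_ineq)
    also have "\<dots> < e" using h(2)[of m] h(2)[of n] M[OF that] by (simp add: dist_norm)
    finally show ?thesis by (simp add: dist_norm)
  qed
  then show "\<exists>M. \<forall>m\<ge>M. \<forall>n\<ge>M. dist (y m) (y n) < e" by blast
qed

text \<open>
  With \<open>\<phi> i\<close> a functional norming \<open>A i (x i)\<close>, the matrix \<open>\<phi> i (A i (x j)) / norm (A i (x i))\<close> has unit
  diagonal. The factor \<open>sqrt (w j)\<close> in front of coefficients that are bounded in the Euclidean
  norm is what allows the passage to infinitely many operators.
\<close>
lemma plank_operators_finite:
  fixes A :: "nat \<Rightarrow> 'a::real_normed_vector \<Rightarrow> 'b::real_normed_vector"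
  assumes A: "\<And>i. i < n \<Longrightarrow> linear (A i)" and w: "\<And>i. i < n \<Longrightarrow> w i > 0"
    and nz: "\<And>i. i < n \<Longrightarrow> A i (x i) \<noteq> 0"
  shows "\<exists>c. (\<Sum>j<n. (c j)\<^sup>2) \<le> (\<Sum>j<n. w j) \<and>
    (\<forall>i<n. w i * norm (A i (x i)) \<le> norm (A i (\<Sum>j<n. (sqrt (w j) * c j) *\<^sub>R x j)))"
proof -
  have "\<exists>\<phi>. \<phi> i = norm (A i (x i)) \<and>
      (\<forall>c. \<bar>\<Sum>j<n. c j * \<phi> j\<bar> \<le> norm (\<Sum>j<n. c j *\<^sub>R A i (x j)))" for i
    using norming_functional[of i "\<lambda>j. A i (x j)" n] .
  then obtain \<phi> where \<phi>: "\<And>i. \<phi> i i = norm (A i (x i))"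
    "\<And>i c. \<bar>\<Sum>j<n. c j * \<phi> i j\<bar> \<le> norm (\<Sum>j<n. c j *\<^sub>R A i (x j))" by metis
  define a where "a i j = \<phi> i j / norm (A i (x i))" for i j
  have diag: "a i i = 1" if "i < n" for i using nz[OF that] by (simp add: a_def \<phi>(1))
  obtain c where c: "(\<Sum>j<n. (c j)\<^sup>2) \<le> (\<Sum>j<n. w j)"
    "\<And>i. i < n \<Longrightarrow> w i \<le> \<bar>\<Sum>j<n. a i j * (sqrt (w j) * c j)\<bar>"
    using plank_matrix[of n w a, OF w diag] by blast
  have "w i * norm (A i (x i)) \<le> norm (A i (\<Sum>j<n. (sqrt (w j) * c j) *\<^sub>R x j))" if i: "i < n" for i
  proof -
    have pos: "norm (A i (x i)) > 0" using nz[OF i] by simp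
    have "w i * norm (A i (x i)) \<le> \<bar>\<Sum>j<n. a i j * (sqrt (w j) * c j)\<bar> * norm (A i (x i))"
      using c(2)[OF i] by (intro mult_right_mono) auto
    also have "\<dots> = \<bar>(\<Sum>j<n. a i j * (sqrt (w j) * c j)) * norm (A i (x i))\<bar>"
      by (simp add: abs_mult)
    also have "(\<Sum>j<n. a i j * (sqrt (w j) * c j)) * norm (A i (x i)) =
        (\<Sum>j<n. (sqrt (w j) * c j) * \<phi> i j)"
      unfolding sum_distrib_right using pos by (intro sum.cong) (auto simp: a_def)
    also have "\<bar>\<dots>\<bar> \<le> norm (\<Sum>j<n. (sqrt (w j) * c j) *\<^sub>R A i (x j))" by (rule \<phi>(2))
    also have "(\<Sum>j<n. (sqrt (w j) * c j) *\<^sub>R A i (x j)) = A i (\<Sum>j<n. (sqrt (w j) * c j) *\<^sub>R x j)"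
      using A[OF i] by (simp add: linear_sum linear_scale)
    finally show ?thesis .
  qed
  with c(1) show ?thesis by blast
qed

text \<open>
  The solutions \<open>y n\<close> for the first \<open>n\<close> operators have coefficients \<open>sqrt (w j) * c n j\<close> in which \<open>c n\<close>
  stays in a ball of \<open>\<ell>\<^sup>2\<close>. Along a subsequence \<open>c n\<close> converges in each coordinate. By the
  Cauchy-Schwarz inequality the part of \<open>y n\<close> beyond index \<open>M\<close> has norm at most
  \<open>sqrt (\<Sum>j\<ge>M. w j) * sqrt W\<close>, uniformly in \<open>n\<close>, so the \<open>y n\<close> converge in norm along the subsequence.
\<close>
theorem plank_operators:
  fixes A :: "nat \<Rightarrow> 'a::real_normed_vector \<Rightarrow> 'b::real_normed_vector"
  assumes complete: "complete (UNIV :: 'a set)"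
    and A: "\<And>i. bounded_linear (A i)" and nz: "\<And>i. onorm (A i) > 0"
    and w: "\<And>i. w i > 0" "summable w"
  shows "\<exists>z. \<forall>i. w i * onorm (A i) / 2 \<le> norm (A i z)"
proof -
  have "\<exists>x. norm x = 1 \<and> onorm (A i) / 2 < norm (A i x)" for i
    using bounded_linear_almost_norming_vector[OF A[of i], of "onorm (A i) / 2"] nz[of i] by simp
  then obtain x where x: "\<And>i. norm (x i) = 1" "\<And>i. onorm (A i) / 2 < norm (A i (x i))" by metis
  have Ax: "A i (x i) \<noteq> 0" for i using x(2)[of i] nz[of i] by auto
  define W where "W = suminf w"
  have wW: "(\<Sum>i<n. w i) \<le> W" for n unfolding W_def
    by (intro sum_le_suminf w(2)) (auto intro: less_imp_le w(1))
  have W0: "W \<ge> 0" using wW[of 0] by simp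
  define P where "P n c \<longleftrightarrow> (\<Sum>j<n. (c j)\<^sup>2) \<le> (\<Sum>j<n. w j) \<and>
    (\<forall>i<n. w i * norm (A i (x i)) \<le> norm (A i (\<Sum>j<n. (sqrt (w j) * c j) *\<^sub>R x j)))" for n c
  have "\<exists>c. P n c" for n
    unfolding P_def by (intro plank_operators_finite bounded_linear.linear[OF A] w(1) Ax)
  then obtain c0 where P: "\<And>n. P n (c0 n)" by metis
  have c0: "(\<Sum>j<n. (c0 n j)\<^sup>2) \<le> (\<Sum>j<n. w j)" for n
    using P[of n] by (simp add: P_def)
  have c0': "w i * norm (A i (x i)) \<le> norm (A i (\<Sum>j<n. (sqrt (w j) * c0 n j) *\<^sub>R x j))"
    if "i < n" for i n
    using P[of n] that by (simp add: P_def)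
  define c where "c n j = (if j < n then c0 n j else 0)" for n j
  define y where "y n = (\<Sum>j<n. (sqrt (w j) * c n j) *\<^sub>R x j)" for n
  have c2: "(\<Sum>j\<in>J. (c n j)\<^sup>2) \<le> W" if "finite J" for J n
  proof -
    have "(\<Sum>j\<in>J. (c n j)\<^sup>2) = (\<Sum>j\<in>J \<inter> {..<n}. (c n j)\<^sup>2)"
      using that by (intro sum.mono_neutral_right) (auto simp: c_def)
    also have "\<dots> \<le> (\<Sum>j<n. (c n j)\<^sup>2)" by (intro sum_mono2) auto
    also have "\<dots> = (\<Sum>j<n. (c0 n j)\<^sup>2)" by (intro sum.cong) (auto simp: c_def)
    also have "\<dots> \<le> W" using c0 wW order_trans by blast
    finally show ?thesis .
  qed
  have y: "w i * norm (A i (x i)) \<le> norm (A i (y n))" if "i < n" for i n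
  proof -
    have "y n = (\<Sum>j<n. (sqrt (w j) * c0 n j) *\<^sub>R x j)"
      unfolding y_def by (intro sum.cong) (auto simp: c_def)
    then show ?thesis using c0'[OF that] by (simp only:)
  qed
  have "c n j \<in> {- sqrt W..sqrt W}" for n j
    using c2[of "{j}" n] real_le_rsqrt[of "c n j" W] real_le_rsqrt[of "- c n j" W] by simp
  then obtain l r where r: "strict_mono (r :: nat \<Rightarrow> nat)" and l: "\<And>j. (\<lambda>n. c (r n) j) \<longlonglongrightarrow> l j"
    using coordinatewise_convergent_subsequence[of "\<lambda>_. {- sqrt W..sqrt W}" c] by auto
  have "Cauchy (\<lambda>n. y (r n))"
  proof (rule Cauchy_if_uniformly_approximable)
    fix e :: real assume e: "e > 0"
    \<comment> \<open>Tails of \<open>w\<close> below \<open>d\<close> make the tails of \<open>y n\<close> at most \<open>sqrt (d * W) \<le> e\<close>.\<close>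
    define d where "d = e\<^sup>2 / (W + 1)"
    have "d > 0" using e W0 by (simp add: d_def)
    then obtain M where M: "\<And>m n. m \<ge> M \<Longrightarrow> norm (sum w {m..<n}) < d"
      using w(2) unfolding summable_Cauchy by blast
    define h where "h n = (\<Sum>j<M. (sqrt (w j) * c n j) *\<^sub>R x j)" for n
    have "norm (y n - h n) \<le> e" for n
    proof -
      have "y n = h n + (\<Sum>j\<in>{M..<n}. (sqrt (w j) * c n j) *\<^sub>R x j)"
      proof (cases "M \<le> n")
        case True
        then have "{..<n} = {..<M} \<union> {M..<n}" by auto
        then show ?thesis unfolding y_def h_def by (simp add: sum.union_disjoint ivl_disj_int)
      next
        case False
        then have "h n = y n" unfolding y_def h_def
          by (intro sum.mono_neutral_right) (auto simp: c_def)
        then show ?thesis using False by simp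
      qed
      then have "norm (y n - h n) \<le> (\<Sum>j\<in>{M..<n}. norm ((sqrt (w j) * c n j) *\<^sub>R x j))"
        using norm_sum[of "\<lambda>j. (sqrt (w j) * c n j) *\<^sub>R x j" "{M..<n}"] by simp
      also have "\<dots> = (\<Sum>j\<in>{M..<n}. sqrt (w j) * \<bar>c n j\<bar>)"
        using w(1) by (intro sum.cong) (auto simp: x(1) abs_mult less_imp_le)
      finally have le: "norm (y n - h n) \<le> (\<Sum>j\<in>{M..<n}. sqrt (w j) * \<bar>c n j\<bar>)" .
      have "(\<Sum>j\<in>{M..<n}. sqrt (w j) * \<bar>c n j\<bar>)\<^sup>2
          \<le> (\<Sum>j\<in>{M..<n}. (sqrt (w j))\<^sup>2) * (\<Sum>j\<in>{M..<n}. \<bar>c n j\<bar>\<^sup>2)"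
        by (rule Cauchy_Schwarz_ineq_sum)
      also have "(\<Sum>j\<in>{M..<n}. (sqrt (w j))\<^sup>2) = sum w {M..<n}"
        using w(1) by (simp add: less_imp_le)
      also have "sum w {M..<n} * (\<Sum>j\<in>{M..<n}. \<bar>c n j\<bar>\<^sup>2) \<le> d * W"
        using M[of M n] c2[of "{M..<n}" n] \<open>d > 0\<close> by (intro mult_mono) (auto intro!: sum_nonneg)
      also have "\<dots> \<le> e\<^sup>2" using W0 by (simp add: d_def field_simps)
      finally have "(\<Sum>j\<in>{M..<n}. sqrt (w j) * \<bar>c n j\<bar>) \<le> e"
        by (rule power2_le_imp_le) (use e in simp)
      with le show ?thesis by (rule order_trans)
    qed
    moreover have "(\<lambda>n. h (r n)) \<longlonglongrightarrow> (\<Sum>j<M. (sqrt (w j) * l j) *\<^sub>R x j)"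
      unfolding h_def by (intro tendsto_intros l)
    then have "convergent (\<lambda>n. h (r n))" by (rule convergentI)
    ultimately show "\<exists>h. convergent h \<and> (\<forall>n. norm (y (r n) - h n) \<le> e)" by blast
  qed
  then obtain z where z: "(\<lambda>n. y (r n)) \<longlonglongrightarrow> z" using complete by (auto simp: complete_def)
  have "w i * onorm (A i) / 2 \<le> norm (A i z)" for i
  proof -
    have "(\<lambda>n. norm (A i (y (r n)))) \<longlonglongrightarrow> norm (A i z)"
      by (intro tendsto_norm bounded_linear.tendsto[OF A] z)
    moreover have "\<forall>\<^sub>F n in sequentially. w i * onorm (A i) / 2 \<le> norm (A i (y (r n)))"
    proof (rule eventually_sequentiallyI)
      fix n assume "Suc i \<le> n"
      then have "i < r n" using seq_suble[OF r, of n] by simp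
      have "w i * onorm (A i) / 2 \<le> w i * norm (A i (x i))"
        using x(2)[of i] w(1)[of i] by (simp add: less_imp_le)
      also have "\<dots> \<le> norm (A i (y (r n)))" by (rule y[OF \<open>i < r n\<close>])
      finally show "w i * onorm (A i) / 2 \<le> norm (A i (y (r n)))" .
    qed
    ultimately show ?thesis by (intro tendsto_lowerbound) auto
  qed
  then show ?thesis by blast
qed

section \<open>Planks in complex Hilbert spaces\<close>

text \<open>
  The polynomial \<open>\<Prod> (1 + \<zeta> c k) ^ m k\<close> has the value 1 at the origin. On the circle of radius \<open>R\<close> the factor
  \<open>1 + \<zeta> c j\<close> has the same modulus as \<open>\<zeta> / R + R cnj (c j)\<close>, which is \<open>R \<bar>c j\<bar>\<close> in modulus at the origin.
  The maximum modulus principle for the product with this factor exchanged shows that a zero of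
  high order near the origin makes the polynomial large on the circle.
\<close>
lemma flipped_factor_bound:
  fixes c :: "nat \<Rightarrow> complex" and m :: "nat \<Rightarrow> nat"
  assumes R: "R > 0" and j: "j < n"
    and B: "\<And>\<zeta>. cmod \<zeta> = R \<Longrightarrow> (\<Prod>k<n. cmod (1 + \<zeta> * c k) ^ m k) \<le> B"
  shows "(R * cmod (c j)) ^ m j \<le> B"
proof -
  define G where "G \<zeta> = (\<zeta> / of_real R + of_real R * cnj (c j)) ^ m j *
    (\<Prod>k\<in>{..<n}-{j}. (1 + \<zeta> * c k) ^ m k)" for \<zeta>
  have "norm (G 0) \<le> B"
  proof (rule maximum_modulus_frontier[of G "ball 0 R"])
    show "G holomorphic_on interior (ball 0 R)" "continuous_on (closure (ball 0 R)) G"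
      unfolding G_def using R by (auto intro!: holomorphic_intros continuous_intros)
    fix \<zeta> :: complex assume "\<zeta> \<in> frontier (ball 0 R)"
    then have \<zeta>: "cmod \<zeta> = R" using R by (simp add: frontier_def sphere_def)
    \<comment> \<open>On the circle \<open>cnj \<zeta> = R\<^sup>2 / \<zeta>\<close>.\<close>
    have "\<zeta> / of_real R + of_real R * cnj (c j) = (\<zeta> / of_real R) * cnj (1 + \<zeta> * c j)"
    proof -
      have "\<zeta> * cnj \<zeta> = of_real R * of_real R"
        using complex_norm_square[of \<zeta>] \<zeta> by (simp add: power2_eq_square)
      then have "(\<zeta> / of_real R) * (cnj \<zeta> * cnj (c j)) = of_real R * cnj (c j)"
        using R by (simp add: field_simps)
      then show ?thesis by (simp add: distrib_left)
    qed
    then have "cmod (\<zeta> / of_real R + of_real R * cnj (c j)) = cmod (\<zeta> / of_real R) * cmod (cnj (1 + \<zeta> * c j))"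
      by (simp only: norm_mult)
    also have "\<dots> = cmod (1 + \<zeta> * c j)"
      unfolding complex_mod_cnj using \<zeta> R by (simp add: norm_divide)
    finally have "norm (G \<zeta>) = cmod (1 + \<zeta> * c j) ^ m j * (\<Prod>k\<in>{..<n}-{j}. cmod (1 + \<zeta> * c k) ^ m k)"
      by (simp add: G_def norm_mult norm_power flip: prod_norm)
    also have "\<dots> = (\<Prod>k<n. cmod (1 + \<zeta> * c k) ^ m k)"
      using j by (simp add: prod.remove[of "{..<n}" j])
    finally show "norm (G \<zeta>) \<le> B" using B[OF \<zeta>] by simp
  qed (use R in auto)
  moreover have "norm (G 0) = (R * cmod (c j)) ^ m j"
    using R by (simp add: G_def norm_mult norm_power)
  ultimately show ?thesis by simp
qed

locale complex_inner_product_space =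
  fixes smul :: "complex \<Rightarrow> 'a::real_normed_vector \<Rightarrow> 'a"
    and ip :: "'a \<Rightarrow> 'a \<Rightarrow> complex"
  assumes smul_of_real: "smul (of_real r) x = r *\<^sub>R x"
    and norm_smul: "norm (smul c x) = cmod c * norm x"
    and ip_add_left: "ip (x + y) z = ip x z + ip y z"
    and ip_smul_left: "ip (smul c x) y = c * ip x y"
    and ip_cnj: "ip y x = cnj (ip x y)"
    and ip_self: "ip x x = of_real ((norm x)\<^sup>2)"
begin

definition complex_linear_functional :: "('a \<Rightarrow> complex) \<Rightarrow> bool" where
  "complex_linear_functional f \<longleftrightarrow>
     (\<forall>x y. f (x + y) = f x + f y) \<and> (\<forall>c x. f (smul c x) = c * f x)"

lemma functional_add: "complex_linear_functional f \<Longrightarrow> f (x + y) = f x + f y"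
  and functional_smul: "complex_linear_functional f \<Longrightarrow> f (smul c x) = c * f x"
  by (auto simp: complex_linear_functional_def)

lemma functional_scaleR: "complex_linear_functional f \<Longrightarrow> f (r *\<^sub>R x) = of_real r * f x"
  using functional_smul[of f "of_real r" x] by (simp add: smul_of_real)

lemma functional_bounded_linear:
  assumes "complex_linear_functional f" "\<And>x. cmod (f x) \<le> norm x"
  shows "bounded_linear f"
proof (rule bounded_linear_intro[where K = 1])
  show "f (r *\<^sub>R x) = r *\<^sub>R f x" for r x
    using functional_scaleR[OF assms(1)] by (simp add: scaleR_conv_of_real)
qed (use assms in \<open>auto simp: functional_add\<close>)

lemma ip_add_right: "ip x (y + z) = ip x y + ip x z"
  by (subst (1 2 3) ip_cnj) (simp add: ip_add_left)

lemma ip_smul_right: "ip x (smul c y) = cnj c * ip x y"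
  by (subst (1 2) ip_cnj) (simp add: ip_smul_left)

lemma norm_add_sq: "(norm (x + y))\<^sup>2 = (norm x)\<^sup>2 + 2 * Re (ip x y) + (norm y)\<^sup>2"
proof -
  have "complex_of_real ((norm (x + y))\<^sup>2) = ip (x + y) (x + y)" by (simp add: ip_self)
  also have "\<dots> = ip x x + (ip x y + cnj (ip x y)) + ip y y"
    by (simp add: ip_add_left ip_add_right ip_cnj[of y x])
  also have "ip x y + cnj (ip x y) = of_real (2 * Re (ip x y))" by (rule complex_add_cnj)
  also have "ip x x + \<dots> + ip y y = complex_of_real ((norm x)\<^sup>2 + 2 * Re (ip x y) + (norm y)\<^sup>2)"
    by (simp add: ip_self)
  finally show ?thesis by (simp only: of_real_eq_iff)
qed

lemma smul_minus_one: "smul (- 1) x = - x"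
  using smul_of_real[of "-1" x] by simp

lemma parallelogram:
  fixes x y :: 'a
  shows "(norm (x - y))\<^sup>2 = 2 * (norm x)\<^sup>2 + 2 * (norm y)\<^sup>2 - (norm (x + y))\<^sup>2"
proof -
  have "ip x (- y) = - ip x y" using ip_smul_right[of x "- 1" y] by (simp add: smul_minus_one)
  then show ?thesis using norm_add_sq[of x "- y"] norm_add_sq[of x y] by simp
qed

lemma pythagoras: "ip u z = 0 \<Longrightarrow> (norm (z + smul c u))\<^sup>2 = (norm z)\<^sup>2 + (cmod c)\<^sup>2 * (norm u)\<^sup>2"
  using ip_cnj[of z u] by (simp add: norm_add_sq ip_smul_right norm_smul power_mult_distrib)

lemma orthogonal_decomposition:
  assumes z: "norm z = 1"
  obtains u where "x = u + smul (ip x z) z" "ip u z = 0" "norm u \<le> norm x" "cmod (ip x z) \<le> norm x"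
proof -
  define u where "u = x + smul (- ip x z) z"
  \<comment> \<open>Additivity of \<open>smul\<close> in the scalar follows from the inner product: the sum has norm zero.\<close>
  have neg: "smul (- c) z = - smul c z" for c
  proof -
    have 0: "smul (- c) z + smul c z = 0"
    proof -
      have "ip (smul (- c) z + smul c z) (smul (- c) z + smul c z) = 0"
        by (simp add: ip_add_left ip_smul_left)
      then show ?thesis by (simp add: ip_self)
    qed
    then show ?thesis by (simp add: eq_neg_iff_add_eq_0)
  qed
  have x: "x = u + smul (ip x z) z" by (simp add: u_def neg)
  have uz: "ip u z = 0" using z by (simp add: u_def ip_add_left ip_smul_left ip_self)
  have "(norm x)\<^sup>2 = (norm u)\<^sup>2 + (cmod (ip x z))\<^sup>2"
    by (subst x) (use uz z in \<open>simp add: norm_add_sq ip_smul_right norm_smul\<close>)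
  then have "(norm u)\<^sup>2 \<le> (norm x)\<^sup>2" "(cmod (ip x z))\<^sup>2 \<le> (norm x)\<^sup>2" by simp_all
  then have "norm u \<le> norm x" "cmod (ip x z) \<le> norm x"
    using power2_le_imp_le norm_ge_zero by blast+
  with x uz show thesis using that by blast
qed

lemma Cauchy_Schwarz: "cmod (ip x y) \<le> norm x * norm y"
proof (cases "y = 0")
  case True
  have "ip x 0 = 0" using ip_add_right[of x 0 0] by simp
  with True show ?thesis by simp
next
  case False
  have "norm ((1 / norm y) *\<^sub>R y) = 1" using False by simp
  then have "cmod (ip x ((1 / norm y) *\<^sub>R y)) \<le> norm x" using orthogonal_decomposition by blast
  moreover have "ip x ((1 / norm y) *\<^sub>R y) = of_real (1 / norm y) * ip x y"
    using ip_smul_right[of x "of_real (1 / norm y)" y] by (simp only: smul_of_real complex_cnj_complex_of_real)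
  ultimately show ?thesis using False by (simp add: norm_mult norm_divide field_simps)
qed

text \<open>
  A point where the first \<open>n\<close> functionals do not vanish is moved along \<open>x n\<close>; each functional
  excludes at most one parameter on that line.
\<close>
lemma common_nonzero:
  fixes n :: nat
  assumes f: "\<And>k. k < n \<Longrightarrow> complex_linear_functional (f k)" and x: "\<And>k. k < n \<Longrightarrow> f k (x k) \<noteq> 0"
  shows "\<exists>z. \<forall>k<n. f k z \<noteq> 0"
  using f x
proof (induction n)
  case (Suc n)
  then obtain z where z: "\<And>k. k < n \<Longrightarrow> f k z \<noteq> 0" by force
  have "finite {t. f k z + of_real t * f k (x n) = 0}" if "k < Suc n" for k
  proof (cases "f k (x n) = 0")
    case True
    then have "k < n" using that Suc.prems(2)[of n] by (cases "k = n") auto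
    then show ?thesis using z True by simp
  next
    case False
    then have "{t. f k z + of_real t * f k (x n) = 0} \<subseteq> {t. complex_of_real t = - f k z / f k (x n)}"
      by (auto simp: field_simps add_eq_0_iff)
    moreover have "finite {t. complex_of_real t = c}" for c
      by (rule finite_subset[of _ "{Re c}"]) auto
    ultimately show ?thesis using finite_subset by blast
  qed
  then have "finite (\<Union>k<Suc n. {t. f k z + of_real t * f k (x n) = 0})" by blast
  then obtain t where "t \<notin> (\<Union>k<Suc n. {t. f k z + of_real t * f k (x n) = 0})"
    using ex_new_if_finite[OF infinite_UNIV_char_0] by blast
  then have "f k (z + t *\<^sub>R x n) \<noteq> 0" if "k < Suc n" for k
    using that Suc.prems(1)[OF that] by (auto simp: functional_add functional_scaleR)
  then show ?case by blast
qed auto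

text \<open>
  Let \<open>M\<close> be the sum of the multiplicities and let \<open>z\<close> be a unit vector at which
  \<open>\<Prod> \<bar>f k z\<bar> ^ m k\<close> is at least half its supremum. For \<open>u\<close> orthogonal to \<open>z\<close> with \<open>norm u \<le> 1\<close>, and
  \<open>\<bar>\<zeta>\<bar> = R\<close> with \<open>R\<^sup>2 = m j / M\<close>, Pythagoras gives \<open>norm (z + \<zeta> u) \<le> 1 + R\<^sup>2\<close>, so the product at
  \<open>z + \<zeta> u\<close> exceeds that at \<open>z\<close> at most by the factor \<open>2 exp (m j) \<le> 6 ^ m j\<close>. By the preceding bound
  for polynomials, \<open>R \<bar>f j u / f j z\<bar> \<le> 6\<close>. Taking for \<open>u\<close> the part of \<open>x j\<close> orthogonal to \<open>z\<close> keeps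
  \<open>\<bar>f j u\<bar>\<close> at least 1/4, unless \<open>\<bar>f j z\<bar>\<close> is at least 1/4 already.
\<close>
lemma plank_multiplicities:
  fixes m :: "nat \<Rightarrow> nat"
  assumes f: "\<And>k. k < n \<Longrightarrow> complex_linear_functional (f k)"
    and f1: "\<And>k z. k < n \<Longrightarrow> cmod (f k z) \<le> norm z"
    and x: "\<And>k. k < n \<Longrightarrow> norm (x k) \<le> 1" "\<And>k. k < n \<Longrightarrow> cmod (f k (x k)) \<ge> 1 / 2"
    and m: "\<And>k. k < n \<Longrightarrow> m k > 0"
  shows "\<exists>z. norm z \<le> 1 \<and> (\<forall>k<n. sqrt (m k / (\<Sum>k<n. m k)) / 24 \<le> cmod (f k z))"
proof (cases "n = 0")
  case True
  then show ?thesis by (intro exI[of _ 0]) simp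
next
  case False
  define M where "M = (\<Sum>k<n. m k)"
  define F where "F z = (\<Prod>k<n. cmod (f k z) ^ m k)" for z
  have mM: "m k \<le> M" if "k < n" for k unfolding M_def using that by (intro member_le_sum) auto
  have M: "M > 0" using False mM[of 0] m[of 0] by simp
  have F_scale: "F (r *\<^sub>R z) = r ^ M * F z" if "r \<ge> 0" for r z
  proof -
    have "F (r *\<^sub>R z) = (\<Prod>k<n. r ^ m k * cmod (f k z) ^ m k)" unfolding F_def
      using that f by (intro prod.cong) (auto simp: functional_scaleR norm_mult power_mult_distrib)
    then show ?thesis by (simp add: F_def M_def prod.distrib power_sum)
  qed
  have F1: "F z \<le> 1" if "norm z = 1" for z
    unfolding F_def using f1[of _ z] that by (intro prod_le_1) (auto intro: power_le_one)
  have F_pos: "F z \<ge> 0" for z unfolding F_def by (intro prod_nonneg) auto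
  obtain z0 where z0: "\<And>k. k < n \<Longrightarrow> f k z0 \<noteq> 0"
    using common_nonzero[of n f x] f x(2) by force
  have z0_nz: "z0 \<noteq> 0" using z0[of 0] f1[of 0 z0] False by auto
  have F_z0: "F z0 > 0" unfolding F_def using z0 by (intro prod_pos) auto
  define S where "S = Sup (F ` {z. norm z = 1})"
  have bdd: "bdd_above (F ` {z. norm z = 1})" using F1 by (intro bdd_aboveI[of _ 1]) auto
  have FS1: "F z \<le> S" if "norm z = 1" for z
    unfolding S_def using that by (intro cSup_upper bdd) auto
  have FS: "F z \<le> S * norm z ^ M" if "z \<noteq> 0" for z
  proof -
    have "F z = norm z ^ M * F ((1 / norm z) *\<^sub>R z)"
      using F_scale[of "norm z" "(1 / norm z) *\<^sub>R z"] that by simp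
    also have "\<dots> \<le> norm z ^ M * S" using that by (intro mult_left_mono FS1) auto
    finally show ?thesis by (simp add: mult.commute)
  qed
  have S: "S > 0"
    using FS[OF z0_nz] F_z0 by (smt (verit) mult_nonpos_nonneg norm_ge_zero zero_le_power)
  then have "\<exists>v\<in>F ` {z. norm z = 1}. S / 2 < v" 
    unfolding S_def[symmetric] 
    by (intro less_cSupD[of _ "S / 2", folded S_def]) (use z0_nz in \<open>auto intro!: exI[of _ "(1 / norm z0) *\<^sub>R z0"] simp: S_def\<close>)
  then obtain z where z: "norm z = 1" "S / 2 < F z" by auto
  have FS0: "F v \<le> S * norm v ^ M" for v
  proof (cases "v = 0")
    case True
    have "F v = 0" using F_scale[of 0 0] M True by (simp add: power_0_left)
    then show ?thesis using S by simp
  qed (rule FS)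
  have fz: "f k z \<noteq> 0" if "k < n" for k
  proof
    assume "f k z = 0"
    then have "F z = 0" unfolding F_def using that m[OF that] by (intro prod_zero) (auto intro!: bexI[of _ k])
    then show False using z(2) S by simp
  qed
  have "sqrt (m j / M) / 24 \<le> cmod (f j z)" if j: "j < n" for j
  proof -
    define R where "R = sqrt (m j / M)"
    have R: "R > 0" "R \<le> 1" "R\<^sup>2 = m j / M" using m[OF j] mM[OF j] M by (auto simp: R_def)
    obtain u where u: "x j = u + smul (ip (x j) z) z" "ip u z = 0" "norm u \<le> norm (x j)"
      "cmod (ip (x j) z) \<le> norm (x j)" using orthogonal_decomposition[OF z(1)] by blast
    have u1: "norm u \<le> 1" "cmod (ip (x j) z) \<le> 1" using u(3,4) x(1)[OF j] by auto
    show ?thesis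
    proof (cases "cmod (f j z) \<ge> 1 / 4")
      case True
      then show ?thesis using R(2) unfolding R_def[symmetric] by simp
    next
      case small: False
      have "f j (x j) = f j u + ip (x j) z * f j z"
        by (subst u(1)) (simp add: functional_add[OF f[OF j]] functional_smul[OF f[OF j]])
      then have "1 / 2 \<le> cmod (f j u) + cmod (ip (x j) z) * cmod (f j z)"
        using x(2)[OF j] norm_triangle_ineq[of "f j u" "ip (x j) z * f j z"] by (simp add: norm_mult)
      also have "\<dots> \<le> cmod (f j u) + 1 * cmod (f j z)" using u1(2)
        by (intro add_left_mono mult_right_mono) auto
      finally have fu: "cmod (f j u) \<ge> 1 / 4" using small by simp
      define c where "c k = f k u / f k z" for k
      have "(R * cmod (c j)) ^ m j \<le> 6 ^ m j"
      proof (rule flipped_factor_bound[OF R(1) j])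
        fix \<zeta> :: complex assume \<zeta>: "cmod \<zeta> = R"
        have "F z * (\<Prod>k<n. cmod (1 + \<zeta> * c k) ^ m k) = F (z + smul \<zeta> u)"
          unfolding F_def prod.distrib[symmetric]
        proof (rule prod.cong[OF refl])
          fix k assume "k \<in> {..<n}"
          then have k: "k < n" by simp
          have "f k (z + smul \<zeta> u) = f k z * (1 + \<zeta> * c k)"
            using fz[OF k] f[OF k] by (simp add: functional_add functional_smul c_def distrib_left)
          then show "cmod (f k z) ^ m k * cmod (1 + \<zeta> * c k) ^ m k = cmod (f k (z + smul \<zeta> u)) ^ m k"
            by (simp add: norm_mult power_mult_distrib)
        qed
        also have "\<dots> \<le> S * norm (z + smul \<zeta> u) ^ M" by (rule FS0)
        also have "\<dots> \<le> S * 3 ^ m j"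
        proof (rule mult_left_mono)
          have "(norm (z + smul \<zeta> u))\<^sup>2 = 1 + R\<^sup>2 * (norm u)\<^sup>2"
            using pythagoras[OF u(2)] z(1) \<zeta> by simp
          also have "\<dots> \<le> 1 + R\<^sup>2 * 1"
            using u1(1) by (intro add_left_mono mult_left_mono) (auto simp: power_le_one)
          also have "\<dots> \<le> (1 + R\<^sup>2)\<^sup>2" using self_le_power[of "1 + R\<^sup>2" 2] by simp
          finally have "norm (z + smul \<zeta> u) \<le> 1 + R\<^sup>2" by (rule power2_le_imp_le) simp
          also have "\<dots> \<le> exp (R\<^sup>2)" by (rule exp_ge_add_one_self)
          finally have "norm (z + smul \<zeta> u) ^ M \<le> exp (R\<^sup>2) ^ M" by (rule power_mono) simp
          also have "\<dots> = exp (m j)" using M R(3) by (simp flip: exp_of_nat_mult)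
          also have "\<dots> = exp 1 ^ m j" by (simp flip: exp_of_nat_mult)
          also have "\<dots> \<le> 3 ^ m j" by (intro power_mono exp_le) auto
          finally show "norm (z + smul \<zeta> u) ^ M \<le> 3 ^ m j" .
        qed (use S in simp)
        also have "\<dots> \<le> F z * (2 * 3 ^ m j)" using z(2) by simp
        finally have "(\<Prod>k<n. cmod (1 + \<zeta> * c k) ^ m k) \<le> 2 * 3 ^ m j"
          using z(2) S by (simp add: mult_le_cancel_left)
        also have "\<dots> \<le> 2 ^ m j * 3 ^ m j"
          using m[OF j] by (intro mult_right_mono self_le_power) auto
        also have "\<dots> = 6 ^ m j" by (simp flip: power_mult_distrib)
        finally show "(\<Prod>k<n. cmod (1 + \<zeta> * c k) ^ m k) \<le> 6 ^ m j" .
      qed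
      then have "R * cmod (c j) \<le> 6" using m[OF j] R(1) by (subst (asm) power_mono_iff) auto
      then have "R * cmod (f j u) \<le> 6 * cmod (f j z)"
        using fz[OF j] by (simp add: c_def norm_divide field_simps)
      moreover have "R * (1 / 4) \<le> R * cmod (f j u)" using fu R by (intro mult_left_mono) auto
      ultimately show ?thesis by (simp add: R_def)
    qed
  qed
  then show ?thesis using z(1) unfolding M_def by (intro exI[of _ z]) simp
qed

text \<open>
  Real weights are reduced to multiplicities by rounding up large multiples of them. The factor
  \<open>L = (n + 1) / P\<close> makes the total rounding error, at most \<open>n\<close>, smaller than the bound \<open>L P\<close> for the exact sum.
\<close>
lemma plank_functionals:
  fixes p :: "nat \<Rightarrow> real"
  assumes f: "\<And>k. k < n \<Longrightarrow> complex_linear_functional (f k)"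
    and f1: "\<And>k z. k < n \<Longrightarrow> cmod (f k z) \<le> norm z"
    and x: "\<And>k. k < n \<Longrightarrow> norm (x k) \<le> 1" "\<And>k. k < n \<Longrightarrow> cmod (f k (x k)) \<ge> 1 / 2"
    and p: "\<And>k. k < n \<Longrightarrow> p k > 0" "(\<Sum>k<n. p k) \<le> P" "P > 0"
  shows "\<exists>z. norm z \<le> 1 \<and> (\<forall>k<n. sqrt (p k / (2 * P)) / 24 \<le> cmod (f k z))"
proof -
  define L where "L = (real n + 1) / P"
  define m where "m k = nat \<lceil>L * p k\<rceil>" for k
  have L: "L > 0" using p(3) by (simp add: L_def)
  have m: "L * p k \<le> m k" "m k \<le> L * p k + 1" "m k > 0" if "k < n" for k
  proof -
    have pos: "L * p k > 0" using L p(1)[OF that] by simp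
    then show "L * p k \<le> m k" "m k \<le> L * p k + 1" unfolding m_def by linarith+
    then show "m k > 0" using pos by linarith
  qed
  obtain z where z: "norm z \<le> 1" "\<And>k. k < n \<Longrightarrow> sqrt (m k / (\<Sum>k<n. m k)) / 24 \<le> cmod (f k z)"
    using plank_multiplicities[of n f x m, OF f f1 x m(3)] by blast
  have "p k / (2 * P) \<le> m k / (\<Sum>k<n. m k)" if k: "k < n" for k
  proof -
    have "real (\<Sum>k<n. m k) \<le> (\<Sum>k<n. L * p k + 1)" unfolding of_nat_sum by (intro sum_mono m) auto
    also have "\<dots> = L * (\<Sum>k<n. p k) + n" by (simp add: sum.distrib sum_distrib_left)
    also have "\<dots> \<le> L * P + L * P" using p L
      by (intro add_mono mult_left_mono) (auto simp: L_def)
    finally have le: "real (\<Sum>k<n. m k) \<le> 2 * (L * P)" by simp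
    have "m k \<le> (\<Sum>k<n. m k)" using k by (intro member_le_sum) auto
    then have pos: "real (\<Sum>k<n. m k) > 0" using m(3)[OF k] by linarith
    have "p k / (2 * P) = L * p k / (2 * (L * P))" using L by simp
    also have "\<dots> \<le> m k / (\<Sum>k<n. m k)" using le m[OF k] pos p L by (intro frac_le) auto
    finally show ?thesis .
  qed
  then have "sqrt (p k / (2 * P)) / 24 \<le> cmod (f k z)" if "k < n" for k
    using z(2)[OF that] that by (meson divide_right_mono order_trans real_sqrt_le_mono zero_le_numeral)
  with z(1) show ?thesis by blast
qed

text \<open>
  A bounded sequence along which all \<open>f k\<close> converge has convex combinations of its tails that
  converge in norm: almost shortest vectors of the decreasing convex hulls form a Cauchy sequence
  by the parallelogram identity, and any such combinations have the same limits under each \<open>f k\<close>.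
\<close>
lemma weak_limit:
  assumes complete: "complete (UNIV :: 'a set)" and z: "\<And>n. norm (z n) \<le> 1"
    and f: "\<And>k. bounded_linear (f k :: 'a \<Rightarrow> complex)"
    and l: "\<And>k. (\<lambda>n. f k (z n)) \<longlonglongrightarrow> l k"
  shows "\<exists>y. \<forall>k. f k y = l k"
proof -
  define T where "T m = convex hull (z ` {m..})" for m :: nat
  define d where "d m = infdist 0 (T m)" for m
  have T_ne: "T m \<noteq> {}" for m by (auto simp: T_def)
  have T_mono: "T n \<subseteq> T m" if "m \<le> n" for m n
    unfolding T_def using that by (intro hull_mono) auto
  have d_le: "d m \<le> norm y" if "y \<in> T m" for m y
    using infdist_le[OF that, of 0] by (simp add: d_def)
  have "incseq d" unfolding d_def by (intro monoI infdist_mono T_mono T_ne)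
  moreover have "d m \<le> 1" for m
  proof -
    have "z m \<in> T m" unfolding T_def by (intro hull_inc) auto
    then show ?thesis using d_le z[of m] by (meson order_trans)
  qed
  ultimately obtain D where D: "d \<longlonglongrightarrow> D" using incseq_convergent[of d 1] by metis
  have "\<exists>y\<in>T m. norm y < d m + 1 / Suc m" for m
  proof -
    have "d m < d m + 1 / Suc m" by simp
    then show ?thesis unfolding d_def infdist_notempty[OF T_ne]
      by (subst (asm) cInf_less_iff) (auto simp: T_ne intro!: bdd_belowI[of _ 0])
  qed
  then obtain y where y: "\<And>m. y m \<in> T m" "\<And>m. norm (y m) < d m + 1 / Suc m" by metis
  have yD: "(\<lambda>m. norm (y m)) \<longlonglongrightarrow> D"
  proof (rule tendsto_sandwich[OF _ _ D])
    show "(\<lambda>m. d m + 1 / Suc m) \<longlonglongrightarrow> D"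
      using tendsto_add[OF D LIMSEQ_inverse_real_of_nat] by (simp add: inverse_eq_divide)
    show "\<forall>\<^sub>F m in sequentially. d m \<le> norm (y m)" using d_le y(1) by simp
    show "\<forall>\<^sub>F m in sequentially. norm (y m) \<le> d m + 1 / Suc m"
      using y(2) by (intro always_eventually allI less_imp_le)
  qed
  have "Cauchy y"
  proof (rule CauchyI')
    fix e :: real assume e: "e > 0"
    have "(\<lambda>m. (norm (y m))\<^sup>2) \<longlonglongrightarrow> D\<^sup>2" "(\<lambda>m. (d m)\<^sup>2) \<longlonglongrightarrow> D\<^sup>2"
      by (intro tendsto_power yD D)+
    then have "\<forall>\<^sub>F m in sequentially. (norm (y m))\<^sup>2 < D\<^sup>2 + e\<^sup>2 / 8 \<and> (d m)\<^sup>2 > D\<^sup>2 - e\<^sup>2 / 8"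
      using e by (intro eventually_conj order_tendstoD) auto
    then obtain M where M: "\<And>m. m \<ge> M \<Longrightarrow> (norm (y m))\<^sup>2 < D\<^sup>2 + e\<^sup>2 / 8 \<and> (d m)\<^sup>2 > D\<^sup>2 - e\<^sup>2 / 8"
      by (auto simp: eventually_sequentially)
    have "dist (y m) (y n) < e" if mn: "m \<ge> M" "n > m" for m n
    proof -
      have "(1 / 2) *\<^sub>R y m + (1 / 2) *\<^sub>R y n \<in> T m"
        using y(1)[of m] y(1)[of n] T_mono[of m n] mn convex_convex_hull
        by (intro convexD) (auto simp: T_def)
      then have "d m \<le> norm ((1 / 2) *\<^sub>R (y m + y n))" using d_le by (simp add: scaleR_add_right)
      then have "2 * d m \<le> norm (y m + y n)" by simp
      then have "(2 * d m)\<^sup>2 \<le> (norm (y m + y n))\<^sup>2" 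
        by (rule power_mono) (simp add: d_def infdist_nonneg)
      then have "(norm (y m - y n))\<^sup>2 \<le> 2 * (norm (y m))\<^sup>2 + 2 * (norm (y n))\<^sup>2 - 4 * (d m)\<^sup>2"
        by (simp add: parallelogram power_mult_distrib)
      also have "\<dots> < e\<^sup>2" using M[of m] M[of n] mn by auto
      finally show ?thesis using e by (simp add: dist_norm power_less_imp_less_base)
    qed
    then show "\<exists>M. \<forall>m\<ge>M. \<forall>n>m. dist (y m) (y n) < e" by blast
  qed
  then obtain v where v: "y \<longlonglongrightarrow> v" using complete by (auto simp: complete_def)
  have "f k v = l k" for k
  proof (rule LIMSEQ_unique)
    show "(\<lambda>m. f k (y m)) \<longlonglongrightarrow> f k v" by (rule bounded_linear.tendsto[OF f v])
    show "(\<lambda>m. f k (y m)) \<longlonglongrightarrow> l k"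
    proof (rule LIMSEQ_I)
      fix r :: real assume r: "r > 0"
      then obtain N where N: "\<And>n. n \<ge> N \<Longrightarrow> norm (f k (z n) - l k) < r"
        using LIMSEQ_D[OF l[of k]] by blast
      have "norm (f k (y n) - l k) < r" if "n \<ge> N" for n
      proof -
        have "convex (f k -` ball (l k) r)"
          by (intro convex_linear_vimage bounded_linear.linear[OF f] convex_ball)
        moreover have "z ` {n..} \<subseteq> f k -` ball (l k) r"
          using N that by (auto simp: dist_norm norm_minus_commute)
        ultimately have "T n \<subseteq> f k -` ball (l k) r" unfolding T_def by (intro hull_minimal)
        then show ?thesis using y(1)[of n] by (auto simp: dist_norm norm_minus_commute)
      qed
      then show "\<exists>N. \<forall>n\<ge>N. norm (f k (y n) - l k) < r" by blast
    qed
  qed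
  then show ?thesis by blast
qed

end

context complex_inner_product_space
begin

text \<open>
  The theorem follows from the one for functionals by testing \<open>A k z\<close> against \<open>A k (x k)\<close>, where
  \<open>x k\<close> is a unit vector that almost norms \<open>A k\<close>.
\<close>
theorem plank_operators_Hilbert:
  assumes complete: "complete (UNIV :: 'a set)"
    and A: "\<And>k. bounded_linear (A k :: 'a \<Rightarrow> 'a)" "\<And>k c x. A k (smul c x) = smul c (A k x)"
    and nz: "\<And>k. onorm (A k) > 0"
    and p: "\<And>k. p k > 0" "summable p"
  shows "\<exists>C>0. \<exists>z. \<forall>k. C * sqrt (p k) * onorm (A k) \<le> norm (A k z)"
proof -
  have "\<exists>x. norm x = 1 \<and> onorm (A k) / 2 < norm (A k x)" for k
    using bounded_linear_almost_norming_vector[OF A(1)[of k], of "onorm (A k) / 2"] nz[of k] by simp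
  then obtain x where x: "\<And>k. norm (x k) = 1" "\<And>k. onorm (A k) / 2 < norm (A k (x k))" by metis
  have Ax: "norm (A k (x k)) > 0" for k using x(2)[of k] nz[of k] by linarith
  define f where "f k z = ip (A k z) (A k (x k)) / of_real (norm (A k (x k)) * onorm (A k))" for k z
  have f: "complex_linear_functional (f k)" for k
    using A bounded_linear.linear[OF A(1)]
    by (simp add: complex_linear_functional_def f_def ip_add_left ip_smul_left linear_add add_divide_distrib)
  have f_le: "cmod (f k z) * onorm (A k) \<le> norm (A k z)" for k z
  proof -
    have "cmod (f k z) * onorm (A k) = cmod (ip (A k z) (A k (x k))) / norm (A k (x k))"
      using nz[of k] Ax[of k] by (simp add: f_def norm_divide norm_mult)
    also have "\<dots> \<le> norm (A k z)" using Cauchy_Schwarz[of "A k z" "A k (x k)"] Ax[of k]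
      by (simp add: field_simps)
    finally show ?thesis .
  qed
  have f1: "cmod (f k z) \<le> norm z" for k z
  proof -
    have "cmod (f k z) * onorm (A k) \<le> norm z * onorm (A k)"
      using order_trans[OF f_le onorm[OF A(1)]] by (simp add: mult.commute)
    then show ?thesis using nz[of k] by simp
  qed
  have fx: "cmod (f k (x k)) \<ge> 1 / 2" for k
    using x(2)[of k] nz[of k] Ax[of k]
    by (simp add: f_def ip_self norm_divide norm_mult power2_eq_square field_simps)
  define P where "P = suminf p"
  have P: "(\<Sum>k<n. p k) \<le> P" for n unfolding P_def
    by (intro sum_le_suminf p(2)) (auto intro: less_imp_le p(1))
  have P0: "P > 0" unfolding P_def by (rule suminf_pos[OF p(2) p(1)])
  define \<delta> where "\<delta> k = sqrt (p k / (2 * P)) / 24" for k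
  have "\<exists>z. norm z \<le> 1 \<and> (\<forall>k<n. \<delta> k \<le> cmod (f k z))" for n
    unfolding \<delta>_def by (rule plank_functionals[of n f x]) (use f f1 x(1) fx p(1) P P0 in auto)
  then obtain z where z: "\<And>n. norm (z n) \<le> 1" "\<And>n k. k < n \<Longrightarrow> \<delta> k \<le> cmod (f k (z n))" by metis
  have "f k (z n) \<in> cball 0 1" for n k using f1[of k "z n"] z(1)[of n] by simp
  then obtain l r where r: "strict_mono (r :: nat \<Rightarrow> nat)" and l: "\<And>k. (\<lambda>n. f k (z (r n))) \<longlonglongrightarrow> l k"
    using coordinatewise_convergent_subsequence[of "\<lambda>_. cball 0 1" "\<lambda>n k. f k (z n)"] by auto
  have l_ge: "\<delta> k \<le> cmod (l k)" for k
  proof (rule tendsto_lowerbound[OF tendsto_norm[OF l]])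
    show "\<forall>\<^sub>F n in sequentially. \<delta> k \<le> norm (f k (z (r n)))"
    proof (rule eventually_sequentiallyI)
      fix n assume "Suc k \<le> n"
      then have "k < r n" using seq_suble[OF r, of n] by simp
      then show "\<delta> k \<le> norm (f k (z (r n)))" by (rule z(2))
    qed
  qed simp
  obtain y where y: "\<And>k. f k y = l k"
    using weak_limit[OF complete, of "\<lambda>n. z (r n)" f l] z(1) functional_bounded_linear[OF f f1] l by blast
  define C where "C = 1 / (24 * sqrt (2 * P))"
  have "C * sqrt (p k) * onorm (A k) \<le> norm (A k y)" for k
  proof -
    have "C * sqrt (p k) = \<delta> k" by (simp add: C_def \<delta>_def real_sqrt_divide)
    also have "\<dots> \<le> cmod (f k y)" using l_ge y by simp
    finally have "C * sqrt (p k) * onorm (A k) \<le> cmod (f k y) * onorm (A k)"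
      using nz[of k] by (intro mult_right_mono) auto
    with f_le show ?thesis by (rule order_trans[rotated])
  qed
  moreover have "C > 0" using P0 by (simp add: C_def)
  ultimately show ?thesis by blast
qed

end

section \<open>Operator sequences tending to infinity at a common vector\<close>

text \<open>
  With \<open>t n\<close> the tail of the series from index \<open>n\<close> on, take \<open>b n = 1 / sqrt (t n)\<close>. Then \<open>b n * a n\<close> is
  \<open>(t n - t (Suc n)) / sqrt (t n)\<close>, at most twice the telescoping difference of the square roots.
\<close>
lemma summable_times_unbounded:
  fixes a :: "nat \<Rightarrow> real"
  assumes a: "\<And>i. a i > 0" "summable a"
  shows "\<exists>b. (\<forall>i. b i > 0) \<and> filterlim b at_top sequentially \<and> summable (\<lambda>i. b i * a i)"
proof -
  define t where "t n = (\<Sum>i. a (i + n))" for n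
  have sm: "summable (\<lambda>i. a (i + n))" for n using a(2) by simp
  have t_pos: "t n > 0" for n unfolding t_def by (rule suminf_pos[OF sm a(1)])
  have t_eq: "t n = suminf a - (\<Sum>i<n. a i)" for n
    unfolding t_def using suminf_minus_initial_segment[OF a(2)] by simp
  have t_Suc: "a n = t n - t (Suc n)" for n by (simp add: t_eq)
  have t_lim: "t \<longlonglongrightarrow> 0"
  proof -
    have "(\<lambda>n. suminf a - (\<Sum>i<n. a i)) \<longlonglongrightarrow> suminf a - suminf a"
      by (intro tendsto_diff tendsto_const summable_LIMSEQ a(2))
    moreover have "t = (\<lambda>n. suminf a - (\<Sum>i<n. a i))" using t_eq by (rule ext)
    ultimately show ?thesis by simp
  qed
  define b where "b n = 1 / sqrt (t n)" for n
  have "b n > 0" for n using t_pos by (simp add: b_def)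
  moreover have "filterlim b at_top sequentially"
  proof -
    have "filterlim (\<lambda>n. sqrt (t n)) (at_right 0) sequentially"
      using tendsto_real_sqrt[OF t_lim] t_pos by (intro tendsto_imp_filterlim_at_right) auto
    then have "filterlim (\<lambda>n. inverse (sqrt (t n))) at_top sequentially"
      by (rule filterlim_compose[OF filterlim_inverse_at_top_right])
    then show ?thesis by (simp add: b_def[abs_def] inverse_eq_divide)
  qed
  moreover have "summable (\<lambda>i. b i * a i)"
  proof (rule summable_comparison_test')
    show "summable (\<lambda>n. 2 * (sqrt (t n) - sqrt (t (Suc n))))"
      by (intro summable_mult telescope_summable'[of _ "sqrt 0"] tendsto_real_sqrt t_lim)
    fix n :: nat
    define u v where "u = sqrt (t n)" and "v = sqrt (t (Suc n))"
    have uv: "u > 0" "v \<ge> 0" "v \<le> u" using t_pos[of n] t_pos[of "Suc n"] t_Suc[of n] a(1)[of n]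
      by (auto simp: u_def v_def)
    have "a n = u\<^sup>2 - v\<^sup>2" using t_Suc[of n] t_pos[of n] t_pos[of "Suc n"] by (simp add: u_def v_def)
    also have "\<dots> = (u - v) * (u + v)" by (simp add: power2_eq_square algebra_simps)
    also have "\<dots> \<le> (u - v) * (2 * u)" using uv by (intro mult_left_mono) auto
    finally have "a n / u \<le> 2 * (u - v)" using uv by (simp add: field_simps)
    then show "norm (b n * a n) \<le> 2 * (sqrt (t n) - sqrt (t (Suc n)))"
      using uv a(1)[of n] by (simp add: b_def u_def v_def)
  qed
  ultimately show ?thesis by blast
qed

lemma summable_interleave:
  fixes g :: "nat \<Rightarrow> nat \<Rightarrow> real"
  assumes N: "N > 0" and g: "\<And>j k. j < N \<Longrightarrow> g j k \<ge> 0" "\<And>j. j < N \<Longrightarrow> summable (g j)"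
  shows "summable (\<lambda>i. g (i mod N) (i div N))"
proof (rule summableI_nonneg_bounded)
  show "g (i mod N) (i div N) \<ge> 0" for i using N g(1) by simp
  fix n
  have "(\<Sum>i<n. g (i mod N) (i div N)) \<le> (\<Sum>i<n * N. g (i mod N) (i div N))"
    using N g(1) by (intro sum_mono2) auto
  also have "\<dots> = (\<Sum>k<n. \<Sum>i\<in>{k * N..<k * N + N}. g (i mod N) (i div N))"
    by (simp add: sum.nat_group)
  also have "\<dots> = (\<Sum>k<n. \<Sum>j<N. g j k)"
  proof (rule sum.cong[OF refl])
    fix k
    have "(\<Sum>i\<in>{k * N..<k * N + N}. g (i mod N) (i div N)) = (\<Sum>j\<in>{0..<N}. g ((j + k * N) mod N) ((j + k * N) div N))"
      using sum.shift_bounds_nat_ivl[of "\<lambda>i. g (i mod N) (i div N)" 0 "k * N" N] by (simp add: add.commute)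
    also have "\<dots> = (\<Sum>j<N. g j k)" using N by (intro sum.cong) auto
    finally show "(\<Sum>i\<in>{k * N..<k * N + N}. g (i mod N) (i div N)) = (\<Sum>j<N. g j k)" .
  qed
  also have "\<dots> = (\<Sum>j<N. \<Sum>k<n. g j k)" by (rule sum.swap)
  also have "\<dots> \<le> (\<Sum>j<N. suminf (g j))"
    by (intro sum_mono sum_le_suminf) (auto intro: g)
  finally show "(\<Sum>i<n. g (i mod N) (i div N)) \<le> (\<Sum>j<N. suminf (g j))" .
qed

text \<open>
  The hypothesis \<open>plank\<close> is the common form of the two plank theorems, with \<open>root 1\<close> for Banach
  spaces and \<open>root 2\<close> for complex Hilbert spaces.
\<close>
lemma orbits_tend_to_infinity:
  fixes B :: "nat \<Rightarrow> nat \<Rightarrow> 'a::real_normed_vector \<Rightarrow> 'b::real_normed_vector"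
  assumes N: "N > 0" and p: "p > 0"
    and B: "\<And>j k. j < N \<Longrightarrow> B j k \<in> \<A>" "\<And>j k. j < N \<Longrightarrow> onorm (B j k) > 0"
    and sum: "\<And>j. j < N \<Longrightarrow> summable (\<lambda>k. 1 / onorm (B j k) ^ p)"
    and plank: "\<And>A w. (\<And>i. A i \<in> \<A>) \<Longrightarrow> (\<And>i. onorm (A i) > 0) \<Longrightarrow> (\<And>i. w i > 0) \<Longrightarrow>
      summable w \<Longrightarrow> \<exists>c>0. \<exists>z. \<forall>i::nat. c * root p (w i) * onorm (A i) \<le> norm (A i z)"
  shows "\<exists>z. \<forall>j<N. filterlim (\<lambda>k. norm (B j k z)) at_top sequentially"
proof -
  define A where "A i = B (i mod N) (i div N)" for i
  define a where "a i = 1 / onorm (A i) ^ p" for i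
  have A: "A i \<in> \<A>" "onorm (A i) > 0" for i using N B by (simp_all add: A_def)
  have a_pos: "a i > 0" for i using A(2) by (simp add: a_def)
  have "summable a" unfolding a_def A_def
    using summable_interleave[of N "\<lambda>j k. 1 / onorm (B j k) ^ p"] N sum B(2) by (simp add: less_imp_le)
  then obtain b where b: "\<And>i. b i > 0" "filterlim b at_top sequentially" "summable (\<lambda>i. b i * a i)"
    using summable_times_unbounded[of a] a_pos by blast
  have "b i * a i > 0" for i using b(1) a_pos by simp
  then obtain c z where c: "c > 0" and z: "\<And>i. c * root p (b i * a i) * onorm (A i) \<le> norm (A i z)"
    using plank[of A "\<lambda>i. b i * a i", OF A _ b(3)] by blast
  have z': "c * root p (b i) \<le> norm (A i z)" for i
  proof -
    have "root p (b i * a i) * onorm (A i) = root p (b i)"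
      using A(2)[of i] p by (simp add: a_def real_root_divide real_root_power_cancel)
    then show ?thesis using z[of i] by (simp add: mult.assoc)
  qed
  have root_top: "filterlim (\<lambda>i. c * root p (b i)) at_top sequentially"
  proof (rule filterlim_tendsto_pos_mult_at_top[OF tendsto_const c])
    show "filterlim (\<lambda>i. root p (b i)) at_top sequentially"
    proof (subst filterlim_at_top_gt[where c = 0], intro allI impI)
      fix Z :: real assume "Z > 0"
      have "\<forall>\<^sub>F i in sequentially. Z ^ p \<le> b i" using b(2) by (simp add: filterlim_at_top)
      then show "\<forall>\<^sub>F i in sequentially. Z \<le> root p (b i)"
      proof eventually_elim
        case (elim i)
        then have "root p (Z ^ p) \<le> root p (b i)" using p by simp
        then show ?case using p \<open>Z > 0\<close> by (simp add: real_root_power_cancel)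
      qed
    qed
  qed
  have "filterlim (\<lambda>k. norm (B j k z)) at_top sequentially" if j: "j < N" for j
  proof (rule filterlim_at_top_mono)
    have "filterlim (\<lambda>k. k * N + j) at_top sequentially"
      using N by (intro filterlim_subseq strict_monoI) simp
    then show "filterlim (\<lambda>k. c * root p (b (k * N + j))) at_top sequentially"
      by (rule filterlim_compose[OF root_top])
    show "\<forall>\<^sub>F k in sequentially. c * root p (b (k * N + j)) \<le> norm (B j k z)"
    proof (intro always_eventually allI)
      fix k
      have "A (k * N + j) = B j k" using j by (simp add: A_def)
      then show "c * root p (b (k * N + j)) \<le> norm (B j k z)" using z'[of "k * N + j"] by simp
    qed
  qed
  then show ?thesis by blast
qed

text \<open>
  The convention \<open>1 / 0 = \<infinity>\<close> in \<^typ>\<open>ennreal\<close> makes finiteness of the series exclude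
  vanishing operators.
\<close>
lemma reciprocal_norm_series_finite:
  assumes bl: "\<And>k. bounded_linear (\<lambda>x. (T ^^ Suc k) (C x))" and p: "p > 0"
    and fin: "reciprocal_norm_series p T C < \<infinity>"
  shows "onorm (\<lambda>x. (T ^^ Suc k) (C x)) > 0"
    and "summable (\<lambda>k. 1 / onorm (\<lambda>x. (T ^^ Suc k) (C x)) ^ p)"
proof -
  define s where "s k = onorm (\<lambda>x. (T ^^ Suc k) (C x))" for k
  have fin': "(\<Sum>k. 1 / ennreal (s k) ^ p) < \<infinity>"
    using fin unfolding reciprocal_norm_series_def s_def .
  have s_pos: "s k > 0" for k
  proof (rule ccontr)
    assume "\<not> s k > 0"
    then have "s k = 0" using onorm_pos_le[OF bl[of k]] by (simp add: s_def)
    then show False using ennreal_suminf_lessD[OF fin', of k] p by (simp add: power_0_left)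
  qed
  have "1 / ennreal (s k) ^ p = ennreal (1 / s k ^ p)" for k
    using s_pos[of k] by (simp add: ennreal_power divide_ennreal flip: ennreal_1)
  then have "(\<Sum>k. ennreal (1 / s k ^ p)) \<noteq> top" using fin' by simp
  then have "summable (\<lambda>k. 1 / s k ^ p)"
    using s_pos by (intro summable_suminf_not_top) (auto intro: less_imp_le)
  with s_pos show "onorm (\<lambda>x. (T ^^ Suc k) (C x)) > 0"
    and "summable (\<lambda>k. 1 / onorm (\<lambda>x. (T ^^ Suc k) (C x)) ^ p)"
    by (simp_all add: s_def)
qed

lemma complex_hilbert_space_imp_inner_product_space:
  fixes smul :: "complex \<Rightarrow> 'a::real_normed_vector \<Rightarrow> 'a"
  assumes "complex_hilbert_space K smul"
  shows "\<exists>ip. complex_inner_product_space smul ip"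
proof -
  obtain ip :: "'a \<Rightarrow> 'a \<Rightarrow> complex" where ip:
    "\<And>x y z. ip (x + y) z = ip x z + ip y z" "\<And>c x y. ip (smul c x) y = c * ip x y"
    "\<And>x y. ip y x = cnj (ip x y)" "\<And>x. ip x x = of_real ((norm x)\<^sup>2)"
    using assms unfolding complex_hilbert_space_def by metis
  have "complex_inner_product_space smul ip"
  proof
    show "smul (of_real r) x = r *\<^sub>R x" "norm (smul c x) = cmod c * norm x" for r c x
      using assms unfolding complex_hilbert_space_def normed_space_over_def by auto
  qed (fact ip)+
  then show ?thesis by blast
qed

theorem corollary4p10:
  fixes K :: "complex set"
    and smul :: "complex \<Rightarrow> 'a::real_normed_vector \<Rightarrow> 'a"
    and N :: nat
    and D :: "nat \<Rightarrow> 'a set"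
    and T :: "nat \<Rightarrow> 'a \<Rightarrow> 'a"
    and C :: "'a \<Rightarrow> 'a"
  assumes "normed_space_over K smul"
    and "\<exists>x::'a. x \<noteq> 0"
    and "N \<ge> 2"
    and "\<forall>j\<in>{1..N}. linear_operator_on K smul (D j) (T j)"
    and "C \<in> bounded_operators K smul"
    and "inj C"
    and "\<forall>j\<in>{1..N}. range C \<subseteq> dom_infinity (D j) (T j)"
    and "\<forall>j\<in>{1..N}. \<forall>k. (\<lambda>x. (T j ^^ k) (C x)) \<in> bounded_operators K smul"
    and exactly_one:
      "(complete (UNIV :: 'a set) \<and>
          (\<forall>j\<in>{1..N}. reciprocal_norm_series 1 (T j) C < \<infinity>))
       \<noteq> (complex_hilbert_space K smul \<and>
          (\<forall>j\<in>{1..N}. reciprocal_norm_series 2 (T j) C < \<infinity>))"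
  shows "\<exists>x::'a. \<forall>j\<in>{1..N}.
           filterlim (\<lambda>k. norm ((T j ^^ k) (C x))) at_top sequentially"
proof -
  \<comment> \<open>Both indices are shifted to start at 0; the power \<open>k = 0\<close> is not in the series.\<close>
  define B where "B j k = (\<lambda>x. (T (Suc j) ^^ Suc k) (C x))" for j k
  have B: "B j k \<in> bounded_operators K smul" if "j < N" for j k
    unfolding B_def using assms(8) that by (auto simp del: funpow.simps)
  then have bl: "bounded_linear (B j k)" if "j < N" for j k
    using that by (auto simp: bounded_operators_def)
  have main: ?thesis
    if p: "p > 0" and fin: "\<forall>j\<in>{1..N}. reciprocal_norm_series p (T j) C < \<infinity>"
      and plank: "\<And>A w. (\<And>i. A i \<in> bounded_operators K smul) \<Longrightarrow> (\<And>i. onorm (A i) > 0) \<Longrightarrow>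
        (\<And>i. w i > 0) \<Longrightarrow> summable w \<Longrightarrow>
        \<exists>c>0. \<exists>z. \<forall>i::nat. c * root p (w i) * onorm (A i) \<le> norm (A i z)" for p
  proof -
    have fin': "reciprocal_norm_series p (T (Suc j)) C < \<infinity>" if "j < N" for j
      using fin that by auto
    have bl': "bounded_linear (\<lambda>x. (T (Suc j) ^^ Suc k) (C x))" if "j < N" for j k
      using bl[OF that, of k] by (simp only: B_def)
    have pos: "onorm (B j k) > 0" if "j < N" for j k
      unfolding B_def by (rule reciprocal_norm_series_finite(1)[OF bl'[OF that] p fin'[OF that]])
    have sum: "summable (\<lambda>k. 1 / onorm (B j k) ^ p)" if "j < N" for j
      unfolding B_def by (rule reciprocal_norm_series_finite(2)[OF bl'[OF that] p fin'[OF that]])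
    have "\<exists>z. \<forall>j<N. filterlim (\<lambda>k. norm (B j k z)) at_top sequentially"
    proof (rule orbits_tend_to_infinity[OF _ p B pos sum])
      show "N > 0" using assms(3) by simp
    qed (assumption+, rule plank, blast+)
    then obtain z where z: "\<And>j. j < N \<Longrightarrow> filterlim (\<lambda>k. norm (B j k z)) at_top sequentially"
      by blast
    have "filterlim (\<lambda>k. norm ((T j ^^ k) (C z))) at_top sequentially" if j: "j \<in> {1..N}" for j
    proof -
      have jN: "j - 1 < N" using j by auto
      have "B (j - 1) k = (\<lambda>x. (T j ^^ Suc k) (C x))" for k using j by (simp add: B_def)
      then have "filterlim (\<lambda>k. norm ((T j ^^ Suc k) (C z))) at_top sequentially"
        using z[of "j - 1"] jN by (simp del: funpow.simps)
      then show ?thesis by (subst (asm) filterlim_sequentially_Suc)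
    qed
    then show ?thesis by blast
  qed
  from exactly_one consider
      (Banach) "complete (UNIV :: 'a set)" "\<forall>j\<in>{1..N}. reciprocal_norm_series 1 (T j) C < \<infinity>"
    | (Hilbert) "complex_hilbert_space K smul" "\<forall>j\<in>{1..N}. reciprocal_norm_series 2 (T j) C < \<infinity>"
    by blast
  then show ?thesis
  proof cases
    case Banach
    show ?thesis
    proof (rule main[of 1])
      fix A :: "nat \<Rightarrow> 'a \<Rightarrow> 'a" and w :: "nat \<Rightarrow> real"
      assume "\<And>i. A i \<in> bounded_operators K smul" "\<And>i. onorm (A i) > 0" "\<And>i. w i > 0" "summable w"
      then obtain z where "\<And>i. w i * onorm (A i) / 2 \<le> norm (A i z)"
        using plank_operators[OF Banach(1), of A w] by (auto simp: bounded_operators_def)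
      then show "\<exists>c>0. \<exists>z. \<forall>i. c * root 1 (w i) * onorm (A i) \<le> norm (A i z)"
        by (intro exI[of _ "1 / 2"] conjI exI[of _ z]) auto
    qed (use Banach in auto)
  next
    case Hilbert
    have K: "K = UNIV" "complete (UNIV :: 'a set)"
      using Hilbert(1) by (simp_all add: complex_hilbert_space_def)
    obtain ip where "complex_inner_product_space smul ip"
      using complex_hilbert_space_imp_inner_product_space[OF Hilbert(1)] by blast
    then interpret complex_inner_product_space smul ip .
    show ?thesis
    proof (rule main[of 2])
      fix A :: "nat \<Rightarrow> 'a \<Rightarrow> 'a" and w :: "nat \<Rightarrow> real"
      assume "\<And>i. A i \<in> bounded_operators K smul" "\<And>i. onorm (A i) > 0" "\<And>i. w i > 0" "summable w"
      then show "\<exists>c>0. \<exists>z. \<forall>i. c * root 2 (w i) * onorm (A i) \<le> norm (A i z)"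
        using plank_operators_Hilbert[OF K(2), of A w] K(1)
        by (auto simp: bounded_operators_def sqrt_def)
    qed (use Hilbert in auto)
  qed
qed

end
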